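(* Let $p\in\mathbb{Z}[x]$ be a monic polynomial of degree $d\ge2$, let $T>0$, and let $G\subset[0,T]\times\mathbb{T}$ be a measurable set with positive Lebesgue measure. Then there exists a constant $C(G)>0$ such that for all $u_0\in L^2(\mathbb{T})$, the solution $u(t,x)=e^{itP(D)}u_0(x)$ of $\partial_tu=iP(D)u$, $u(0,\cdot)=u_0$, satisfies $$\|u_0\|^2_{L^2(\mathbb{T})}\le C(G)\iint_G|u(t,x)|^2\,dx\,dt.$$
   Context: $\mathbb{T}=\mathbb{R}/2\pi\mathbb{Z}$. $P(D)$ is the Fourier multiplier $\widehat{P(D)u}(k)=p(k)\widehat u(k)$, $k\in\mathbb{Z}$, with $\widehat u(k)=\frac1{2\pi}\int_0^{2\pi}u(x)e^{-ikx}dx$; thus $e^{itP(D)}u_0=\sum_{k\in\mathbb{Z}}\widehat{u_0}(k)e^{i(kx+p(k)t)}$. *)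

theory Defs
  imports "HOL-Analysis.Analysis" "HOL-Computational_Algebra.Polynomial"
begin

text \<open>
  The circle \<open>\<real>/2\<pi>\<int>\<close> is represented by its fundamental domain \<open>[0, 2\<pi>)\<close>, with Lebesgue
  measure of total mass \<open>2\<pi>\<close>.  A function on the circle is a function on the reals of which only
  the values on the fundamental domain matter.
\<close>

definition circle :: "real set"
  where "circle = {0..<2 * pi}"

definition circle_L2 :: "(real \<Rightarrow> complex) set"
  where "circle_L2 = {f. f \<in> borel_measurable (lebesgue_on circle) \<and>
                         integrable (lebesgue_on circle) (\<lambda>x. (cmod (f x))\<^sup>2)}"

definition L2_norm :: "(real \<Rightarrow> complex) \<Rightarrow> real"
  where "L2_norm f = sqrt (LINT x|lebesgue_on circle. (cmod (f x))\<^sup>2)"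

definition fourier_coeff :: "(real \<Rightarrow> complex) \<Rightarrow> int \<Rightarrow> complex"
  where "fourier_coeff f k =
           1 / (2 * of_real pi) *
           (LINT x|lebesgue_on circle. f x * exp (- \<i> * of_int k * of_real x))"

text \<open>
  \<open>is_multiplier_image m f g\<close>: the function \<open>g\<close> is the image in \<open>L\<^sup>2\<close> of \<open>f\<close> under the Fourier
  multiplier with symbol \<open>m\<close>.  It is a relation, because the Fourier coefficients determine
  \<open>g\<close> only up to a null set.
\<close>

definition is_multiplier_image ::
    "(int \<Rightarrow> complex) \<Rightarrow> (real \<Rightarrow> complex) \<Rightarrow> (real \<Rightarrow> complex) \<Rightarrow> bool"
  where "is_multiplier_image m f g \<longleftrightarrow>
           f \<in> circle_L2 \<and> g \<in> circle_L2 \<and>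
           (\<forall>k. fourier_coeff g k = m k * fourier_coeff f k)"

definition propagator_symbol :: "int poly \<Rightarrow> real \<Rightarrow> int \<Rightarrow> complex"
  where "propagator_symbol p t k = exp (\<i> * of_real t * of_int (poly p k))"

text \<open>
  \<open>is_solution p T u0 u\<close>: the function \<open>u\<close> is a jointly measurable representative of
  \<open>u(t,\<cdot>) = e\<^bsup>itP(D)\<^esup> u0\<close> for \<open>0 \<le> t \<le> T\<close>.  Any two of them agree almost everywhere on
  \<open>[0,T] \<times> [0,2\<pi>)\<close>.  One always exists: as the tails of the coefficients do not depend on \<open>t\<close>,
  the partial sums of \<open>\<Sum>\<^sub>k c\<^sub>k e\<^bsup>i(kx + p(k)t)\<^esup>\<close> along a sufficiently sparse sequence
  converge, for every \<open>t\<close>, at almost every \<open>x\<close> and in \<open>L\<^sup>2\<close>.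
\<close>

definition is_solution ::
    "int poly \<Rightarrow> real \<Rightarrow> (real \<Rightarrow> complex) \<Rightarrow> (real \<Rightarrow> real \<Rightarrow> complex) \<Rightarrow> bool"
  where "is_solution p T u0 u \<longleftrightarrow>
           (\<lambda>(t, x). u t x) \<in> borel_measurable (lebesgue_on ({0..T} \<times> circle)) \<and>
           (\<forall>t\<in>{0..T}. is_multiplier_image (propagator_symbol p t) u0 (u t))"

text \<open>
  On the Fourier side such a \<open>u\<close> solves \<open>\<partial>\<^sub>t u = i P(D) u\<close> with initial value \<open>u0\<close>.
\<close>

lemma is_solution_initial_value:
  assumes "is_solution p T u0 u" "0 \<le> T"
  shows "fourier_coeff (u 0) k = fourier_coeff u0 k"
  using assms by (simp add: is_solution_def is_multiplier_image_def propagator_symbol_def)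

lemma is_solution_fourier_ODE:
  assumes u: "is_solution p T u0 u" and t: "t \<in> {0..T}"
  shows "((\<lambda>s. fourier_coeff (u s) k) has_vector_derivative
           \<i> * (of_int (poly p k) * fourier_coeff (u t) k)) (at t within {0..T})"
proof -
  have eq: "fourier_coeff (u s) k = propagator_symbol p s k * fourier_coeff u0 k"
    if "s \<in> {0..T}" for s
    using u that by (simp add: is_solution_def is_multiplier_image_def)
  have "((\<lambda>z. exp (\<i> * z * of_int (poly p k)) * fourier_coeff u0 k) has_field_derivative
          \<i> * of_int (poly p k) * (exp (\<i> * of_real t * of_int (poly p k)) * fourier_coeff u0 k))
        (at (of_real t))"
    by (auto intro!: derivative_eq_intros)
  from has_vector_derivative_real_field[OF this]
  have deriv: "((\<lambda>s. propagator_symbol p s k * fourier_coeff u0 k) has_vector_derivative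
          \<i> * (of_int (poly p k) * fourier_coeff (u t) k)) (at t within {0..T})"
    by (simp add: propagator_symbol_def eq[OF t] mult.assoc)
  show ?thesis
    by (rule has_vector_derivative_transform[OF t _ deriv]) (rule eq)
qed

end

theory Submission
  imports Defs
begin

text \<open>
  A nonzero difference \<open>(k, p k) - (l, p l)\<close> of two frequencies is attained by at most
  \<open>deg p\<close> pairs \<open>(k, l)\<close>, because \<open>deg p \<ge> 2\<close>.  By Bessel's inequality for the indicator function
  of \<open>G\<close>, the off-diagonal part of the Gram matrix of the exponentials on \<open>G\<close> is therefore
  Hilbert--Schmidt, and discarding finitely many \<open>k\<close> makes it smaller than the diagonal \<open>|G|\<close>.
  The discarded \<open>k\<close> are restored one at a time: \<open>u(t, x + h) - e\<^bsup>i k h\<^esup> u(t, x)\<close> has no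
  \<open>k\<close>-component, and \<open>G \<inter> (G - (0, h))\<close> is close in measure to \<open>G\<close> for small \<open>h\<close>.
  Density of the trigonometric polynomials in \<open>L\<^sup>2\<close> passes from finite sums to all data.
\<close>

section \<open>Orthogonal families and exponentials on space-time boxes\<close>

text \<open>Read from above, the same Hilbert-Schmidt bound says that the mass a wave puts on a set
  is at most its energy times a constant that tends to 0 with the measure of the set. This absorbs
  the part of \<open>G\<close> lost under translation, so no unique continuation or compactness
  argument for solutions enters. Translations act in \<open>x\<close> rather than in
  \<open>t\<close> because distinct frequencies \<open>k\<close> may share the value
  \<open>p k\<close>; a shift in \<open>t\<close> could not tell them apart. Bessel's inequality
  needs one full period in both variables, while \<open>T\<close> is arbitrary and \<open>G\<close>
  is only measurable. Everything is therefore proved on a compact subset of positive measure inside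
  one square of side 2 pi, and this implies the estimate on \<open>G\<close>. Compactness keeps all
  small translates inside an open set of almost the same measure. Degree at least 2 is decisive: for
  an affine \<open>p\<close> the difference of two frequencies depends on \<open>k - l\<close>
  alone, so every difference that occurs is attained infinitely often. The passage to all data works
  because the propagator is unitary: the truncation error is the same at every time.\<close>

lemma borel_measurable_cnj:
  "f \<in> borel_measurable M \<Longrightarrow> (\<lambda>x. cnj (f x)) \<in> borel_measurable M"
  by (rule measurable_compose[OF _ borel_measurable_continuous_onI]) (auto intro: continuous_intros)

lemma integrable_of_square_integrable:
  fixes f :: "'a \<Rightarrow> complex"
  assumes "finite_measure M" "f \<in> borel_measurable M" "integrable M (\<lambda>x. (cmod (f x))\<^sup>2)"
  shows "integrable M f"
proof -
  interpret finite_measure M by fact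
  have *: "integrable M (\<lambda>x. 1 + (cmod (f x))\<^sup>2)"
    using assms(3) by simp
  have le: "r \<le> \<bar>1 + r\<^sup>2\<bar>" for r :: real
    using zero_le_power2[of "r - 1/2"] by (simp add: power2_eq_square algebra_simps)
  show ?thesis
    by (rule Bochner_Integration.integrable_bound[OF * assms(2)]) (use le in auto)
qed

text \<open>Expansion of the square followed by completing the square in \<open>a\<close>. The
  family is orthogonal but not normalised: \<open>C\<close> is the common squared norm. Leaving
  \<open>a\<close> arbitrary serves two purposes: \<open>a = c\<close> gives Bessel's inequality,
  and the last term shows that \<open>c\<close> is the best choice.\<close>

lemma integral_orthogonal_remainder:
  fixes f :: "'a \<Rightarrow> complex" and e :: "'i \<Rightarrow> 'a \<Rightarrow> complex" and C :: real
  assumes M: "finite_measure M" and F: "finite F"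
    and f: "f \<in> borel_measurable M" "integrable M (\<lambda>x. (cmod (f x))\<^sup>2)"
    and e: "\<And>i. e i \<in> borel_measurable M" "\<And>i x. cmod (e i x) \<le> 1"
    and orth: "\<And>i j. (LINT x|M. e i x * cnj (e j x)) = (if i = j then of_real C else 0)"
    and c: "\<And>i. (LINT x|M. f x * cnj (e i x)) = of_real C * c i"
  shows "(LINT x|M. (cmod (f x - (\<Sum>i\<in>F. a i * e i x)))\<^sup>2) =
         (LINT x|M. (cmod (f x))\<^sup>2) - C * (\<Sum>i\<in>F. (cmod (c i))\<^sup>2)
           + C * (\<Sum>i\<in>F. (cmod (a i - c i))\<^sup>2)"
proof -
  interpret finite_measure M by fact
  let ?g = "\<lambda>x. complex_of_real ((cmod (f x))\<^sup>2) - (\<Sum>i\<in>F. cnj (a i) * (f x * cnj (e i x)))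
              - (\<Sum>i\<in>F. a i * cnj (f x * cnj (e i x)))
              + (\<Sum>i\<in>F. \<Sum>j\<in>F. a i * cnj (a j) * (e i x * cnj (e j x)))"
  let ?I = "LINT x|M. (cmod (f x))\<^sup>2"
  have int_f: "integrable M f"
    using M f by (rule integrable_of_square_integrable)
  have int_fe: "integrable M (\<lambda>x. f x * cnj (e i x))" for i
    by (rule Bochner_Integration.integrable_bound[OF int_f])
       (use f e in \<open>auto simp: norm_mult intro!: mult_left_le borel_measurable_times borel_measurable_cnj\<close>)
  have int_ee: "integrable M (\<lambda>x. e i x * cnj (e j x))" for i j
    by (rule integrable_const_bound[where B = 1])
       (use e in \<open>auto simp: norm_mult intro!: mult_le_one borel_measurable_times borel_measurable_cnj\<close>)
  have "has_bochner_integral M ?g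
     (of_real ?I - (\<Sum>i\<in>F. cnj (a i) * (of_real C * c i)) - (\<Sum>i\<in>F. a i * cnj (of_real C * c i))
        + (\<Sum>i\<in>F. \<Sum>j\<in>F. a i * cnj (a j) * (if i = j then of_real C else 0)))"
    by (intro has_bochner_integral_add has_bochner_integral_diff has_bochner_integral_sum
          has_bochner_integral_mult_right has_bochner_integral_of_real has_bochner_integral_cnj)
       (use f int_fe int_ee in \<open>auto simp: has_bochner_integral_iff c orth\<close>)
  also have "?g = (\<lambda>x. of_real ((cmod (f x - (\<Sum>i\<in>F. a i * e i x)))\<^sup>2))"
  proof
    fix x
    have "?g x = (f x - (\<Sum>i\<in>F. a i * e i x)) * (cnj (f x) - (\<Sum>i\<in>F. cnj (a i) * cnj (e i x)))"
      unfolding left_diff_distrib right_diff_distrib sum_product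
      by (simp add: mult_ac sum_distrib_left complex_norm_square del: of_real_power)
    then show "?g x = of_real ((cmod (f x - (\<Sum>i\<in>F. a i * e i x)))\<^sup>2)"
      by (simp add: complex_norm_square del: of_real_power)
  qed
  also have "of_real ?I - (\<Sum>i\<in>F. cnj (a i) * (of_real C * c i)) - (\<Sum>i\<in>F. a i * cnj (of_real C * c i))
        + (\<Sum>i\<in>F. \<Sum>j\<in>F. a i * cnj (a j) * (if i = j then of_real C else 0))
     = complex_of_real (?I - C * (\<Sum>i\<in>F. (cmod (c i))\<^sup>2) + C * (\<Sum>i\<in>F. (cmod (a i - c i))\<^sup>2))"
    using F
    by (simp add: complex_norm_square if_distrib sum.delta sum_distrib_left algebra_simps
                  sum.distrib sum_subtractf cong: if_cong del: of_real_power)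
  finally have *: "has_bochner_integral M (\<lambda>x. complex_of_real ((cmod (f x - (\<Sum>i\<in>F. a i * e i x)))\<^sup>2))
    (complex_of_real (?I - C * (\<Sum>i\<in>F. (cmod (c i))\<^sup>2) + C * (\<Sum>i\<in>F. (cmod (a i - c i))\<^sup>2)))" .
  then show "(LINT x|M. (cmod (f x - (\<Sum>i\<in>F. a i * e i x)))\<^sup>2) =
         (LINT x|M. (cmod (f x))\<^sup>2) - C * (\<Sum>i\<in>F. (cmod (c i))\<^sup>2)
           + C * (\<Sum>i\<in>F. (cmod (a i - c i))\<^sup>2)"
    unfolding has_bochner_integral_iff integral_complex_of_real of_real_eq_iff by blast
qed

text \<open>Points of space-time are written \<open>z = (t, x)\<close>, but frequencies as \<open>(k, p k)\<close>: \<open>chi (m, n)\<close>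
  is \<open>e\<^bsup>i(mx + nt)\<^esup>\<close>.\<close>

definition chi :: "int \<times> int \<Rightarrow> real \<times> real \<Rightarrow> complex"
  where "chi l z = cis (of_int (fst l) * snd z + of_int (snd l) * fst z)"

text \<open>One full period in each variable, the domain on which the functions \<open>chi l\<close>
  are orthogonal. The time origin is free because \<open>T\<close> may exceed 2 pi.\<close>

definition box_at :: "real \<Rightarrow> (real \<times> real) set"
  where "box_at a = cbox (a, 0) (a + 2 * pi, 2 * pi)"

lemma norm_chi [simp]: "cmod (chi l z) = 1"
  by (simp add: chi_def)

lemma chi_mult_cnj: "chi l z * cnj (chi l' z) = chi (l - l') z"
  by (simp add: chi_def cis_mult cis_cnj algebra_simps)

lemma continuous_on_chi [continuous_intros]: "continuous_on A (chi l)"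
  unfolding chi_def by (auto intro!: continuous_intros)

lemma borel_measurable_chi: "chi l \<in> borel_measurable borel"
  by (intro borel_measurable_continuous_onI continuous_on_chi)

lemma has_integral_cis_period:
  fixes k :: int and a :: real
  shows "((\<lambda>x. cis (of_int k * x)) has_integral (if k = 0 then of_real (2 * pi) else 0)) {a..a + 2 * pi}"
proof (cases "k = 0")
  case True
  then show ?thesis
    using has_integral_const_real[of "1::complex" a "a + 2 * pi"] by (simp add: scaleR_conv_of_real)
next
  case False
  let ?F = "\<lambda>x. cis (of_int k * x) / (\<i> * of_int k)"
  have "((\<lambda>x. cis (of_int k * x)) has_integral ?F (a + 2 * pi) - ?F a) {a..a + 2 * pi}"
  proof (rule fundamental_theorem_of_calculus)
    fix x :: real
    have "((\<lambda>z. exp (\<i> * (of_int k * z)) / (\<i> * of_int k)) has_field_derivative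
        exp (\<i> * (of_int k * of_real x))) (at (of_real x))"
      using False by (auto intro!: derivative_eq_intros simp: complex_eq_iff)
    from has_vector_derivative_real_field[OF this]
    show "(?F has_vector_derivative cis (of_int k * x)) (at x within {a..a + 2 * pi})"
      by (simp add: cis_conv_exp)
  qed simp
  moreover have "cis (of_int k * (a + 2 * pi)) = cis (of_int k * a)"
    by (simp add: distrib_left cis_mult[symmetric])
      (metis cis_multiple_2pi Ints_of_int mult.assoc mult.commute mult_1_right)
  ultimately show ?thesis
    using False by simp
qed

lemma integral_chi_box: "integral (box_at a) (chi l) = (if l = 0 then of_real (4 * pi\<^sup>2) else 0)"
proof -
  have "integral (box_at a) (chi l) =
     integral (cbox a (a + 2 * pi)) (\<lambda>t. integral (cbox 0 (2 * pi)) (\<lambda>x. chi l (t, x)))"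
    unfolding box_at_def by (intro integral_prod_continuous continuous_on_chi)
  also have "\<dots> = integral {a..a + 2 * pi} (\<lambda>t. cis (of_int (snd l) * t) *
        (if fst l = 0 then of_real (2 * pi) else 0))"
  proof (intro integral_cong arg_cong2[where f = integral])
    show "cbox a (a + 2 * pi) = {a..a + 2 * pi}" by simp
  next
    have "integral (cbox 0 (2 * pi)) (\<lambda>x. chi l (t, x)) =
      cis (of_int (snd l) * t) * (if fst l = 0 then of_real (2 * pi) else 0)" for t
      using has_integral_mult_right[OF has_integral_cis_period[of "fst l" 0],
          of "cis (of_int (snd l) * t)", THEN integral_unique]
      by (simp add: chi_def cis_mult add.commute)
    then show "(\<lambda>t. integral (cbox 0 (2 * pi)) (\<lambda>x. chi l (t, x))) =
      (\<lambda>t. cis (of_int (snd l) * t) * (if fst l = 0 then of_real (2 * pi) else 0))"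
      by auto
  qed
  also have "\<dots> = (if l = 0 then of_real (4 * pi\<^sup>2) else 0)"
    using has_integral_mult_left[OF has_integral_cis_period[of "snd l" a],
          of "if fst l = 0 then of_real (2 * pi) else 0", THEN integral_unique]
    by (auto simp: prod_eq_iff power2_eq_square scaleR_conv_of_real)
  finally show ?thesis .
qed

lemma set_integrable_continuous_lborel:
  fixes f :: "'a::euclidean_space \<Rightarrow> 'b::{banach, second_countable_topology}"
  assumes "A \<in> sets borel" "bounded A" "continuous_on UNIV f"
  shows "set_integrable lborel A f"
proof -
  obtain b where b: "A \<subseteq> cbox (- b) b"
    using bounded_subset_cbox_symmetric[OF assms(2)] .
  have "set_integrable lborel (cbox (- b) b) f"
    unfolding set_integrable_def
    by (intro borel_integrable_compact) (auto intro: continuous_on_subset[OF assms(3)])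
  then show ?thesis
    by (rule set_integrable_subset) (use assms b in auto)
qed

lemma bounded_box_at: "A \<subseteq> box_at a \<Longrightarrow> bounded A"
  unfolding box_at_def by (meson bounded_cbox bounded_subset)

text \<open>The integrals are, up to conjugation and the factor 1/(4 pi^2), the Fourier coefficients
  of the indicator of \<open>A\<close> on the box, whose area is 4 pi^2.\<close>

lemma bessel_box:
  assumes A: "A \<in> sets borel" "A \<subseteq> box_at a" and F: "finite F"
  shows "(\<Sum>l\<in>F. (cmod (LINT z:A|lborel. chi l z))\<^sup>2) \<le> 4 * pi\<^sup>2 * measure lborel A"
proof -
  let ?M = "restrict_space lborel (box_at a)" and ?f = "\<lambda>z. complex_of_real (indicator A z)"
  let ?c = "\<lambda>l. (LINT z:A|lborel. cnj (chi l z)) / of_real (4 * pi\<^sup>2)"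
  have box: "box_at a \<in> sets lborel" "compact (box_at a)"
    unfolding box_at_def by auto
  have fin: "finite_measure ?M"
    by (rule finite_measureI) (use box in \<open>auto simp: emeasure_restrict_space space_restrict_space
        emeasure_lborel_cbox_eq box_at_def\<close>)
  interpret finite_measure ?M by fact
  have f: "?f \<in> borel_measurable ?M"
    using A by (intro measurable_restrict_space1) auto
  have f2: "integrable ?M (\<lambda>z. (cmod (?f z))\<^sup>2)"
  proof (rule integrable_const_bound[where B = 1])
    show "(\<lambda>z. (cmod (?f z))\<^sup>2) \<in> borel_measurable ?M"
      using f by measurable
  qed (auto simp: indicator_def)
  have e: "chi l \<in> borel_measurable ?M" for l
    by (intro measurable_restrict_space1) (simp add: borel_measurable_chi)
  have orth: "(LINT z|?M. chi l z * cnj (chi l' z)) = (if l = l' then of_real (4 * pi\<^sup>2) else 0)" for l l'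
  proof -
    have "(LINT z|?M. chi l z * cnj (chi l' z)) = (LINT z:box_at a|lborel. chi (l - l') z)"
      using box by (subst integral_restrict_space) (auto simp: chi_mult_cnj set_lebesgue_integral_def)
    also have "\<dots> = integral (box_at a) (chi (l - l'))"
      using box by (intro set_borel_integral_eq_integral set_integrable_continuous_lborel)
        (auto simp: compact_imp_bounded intro: continuous_on_chi)
    finally show ?thesis
      by (simp add: integral_chi_box)
  qed
  have inter: "box_at a \<inter> A = A" using A by auto
  have c: "(LINT z|?M. ?f z * cnj (chi l z)) = of_real (4 * pi\<^sup>2) * ?c l" for l
  proof -
    have "(LINT z|?M. ?f z * cnj (chi l z)) = (LINT z:box_at a|lborel. ?f z * cnj (chi l z))"
      using box by (subst integral_restrict_space) (auto simp: set_lebesgue_integral_def)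
    also have "\<dots> = (LINT z:A|lborel. cnj (chi l z))"
      unfolding set_lebesgue_integral_def using A
      by (intro Bochner_Integration.integral_cong) (auto simp: indicator_def)
    finally show ?thesis by simp
  qed
  have m: "(LINT z|?M. (cmod (?f z))\<^sup>2) = measure lborel A"
  proof -
    have "(LINT z|?M. (cmod (?f z))\<^sup>2) = (LINT z:box_at a|lborel. (cmod (?f z))\<^sup>2)"
      using box by (subst integral_restrict_space) (auto simp: set_lebesgue_integral_def)
    also have "\<dots> = (LINT z|lborel. indicator A z)"
      unfolding set_lebesgue_integral_def using A
      by (intro Bochner_Integration.integral_cong) (auto simp: indicator_def)
    finally show ?thesis using A by simp
  qed
  have "0 \<le> (LINT z|?M. (cmod (?f z - (\<Sum>l\<in>F. ?c l * chi l z)))\<^sup>2)"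
    by (rule integral_nonneg_AE) auto
  also have "\<dots> = measure lborel A - (4 * pi\<^sup>2) * (\<Sum>l\<in>F. (cmod (?c l))\<^sup>2)"
    by (subst integral_orthogonal_remainder[OF fin F f f2 e _ orth c]) (auto simp: m[simplified])
  also have "(4 * pi\<^sup>2) * (\<Sum>l\<in>F. (cmod (?c l))\<^sup>2) = (\<Sum>l\<in>F. (cmod (LINT z:A|lborel. chi l z))\<^sup>2) / (4 * pi\<^sup>2)"
  proof -
    have "cmod (LINT z:A|lborel. cnj (chi l z)) = cmod (LINT z:A|lborel. chi l z)" for l
    proof -
      have "(LINT z:A|lborel. cnj (chi l z)) = cnj (LINT z:A|lborel. chi l z)"
        using Bochner_Integration.integral_cnj[of lborel "\<lambda>z. indicator A z *\<^sub>R chi l z"]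
        by (simp add: set_lebesgue_integral_def del: Bochner_Integration.integral_cnj)
      then show ?thesis by simp
    qed
    then show ?thesis
      by (simp add: norm_divide power_divide sum_distrib_left sum_divide_distrib norm_mult norm_power)
        (simp add: field_simps power2_eq_square power4_eq_xxxx)
  qed
  finally show ?thesis
    by (simp add: field_simps)
qed

section \<open>Gram matrices on subsets of space-time\<close>

definition wave :: "(int \<Rightarrow> int) \<Rightarrow> (int \<Rightarrow> complex) \<Rightarrow> int set \<Rightarrow> real \<times> real \<Rightarrow> complex"
  where "wave \<phi> c F z = (\<Sum>k\<in>F. c k * chi (k, \<phi> k) z)"

definition energy :: "(int \<Rightarrow> complex) \<Rightarrow> int set \<Rightarrow> real"
  where "energy c F = (\<Sum>k\<in>F. (cmod (c k))\<^sup>2)"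

text \<open>Gram entries enter squared, so that sums over off-diagonal pairs are squared
  Hilbert-Schmidt norms. A value depends on the pair only through the difference of its two
  frequencies.\<close>

definition gram_offdiag :: "(int \<Rightarrow> int) \<Rightarrow> (real \<times> real) set \<Rightarrow> int \<times> int \<Rightarrow> real"
  where "gram_offdiag \<phi> A = (\<lambda>(k, l). (cmod (LINT z:A|lborel. chi (k - l, \<phi> k - \<phi> l) z))\<^sup>2)"

text \<open>The one property of \<open>p\<close> that the estimates for finite sums use.
  Off-diagonal pairs have \<open>m \<noteq> 0\<close>. Finiteness is stated separately because
  \<open>card\<close> of an infinite set is 0.\<close>

definition sparse_differences :: "(int \<Rightarrow> int) \<Rightarrow> nat \<Rightarrow> bool"
  where "sparse_differences \<phi> D \<longleftrightarrow> (\<forall>m n. m \<noteq> 0 \<longrightarrow>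
           finite {k. \<phi> (k + m) - \<phi> k = n} \<and> card {k. \<phi> (k + m) - \<phi> k = n} \<le> D)"

text \<open>\<open>K\<close> collects the frequencies still discarded; the aim is
  \<open>K = {}\<close>. The constant is uniform in the finite set \<open>F\<close>, which is what
  survives the limit to infinitely many frequencies.\<close>

definition observable :: "(int \<Rightarrow> int) \<Rightarrow> (real \<times> real) set \<Rightarrow> int set \<Rightarrow> bool"
  where "observable \<phi> A K \<longleftrightarrow> (\<exists>c>0. \<forall>a F. finite F \<longrightarrow> F \<inter> K = {} \<longrightarrow>
           c * energy a F \<le> (LINT z:A|lborel. (cmod (wave \<phi> a F z))\<^sup>2))"

lemma energy_nonneg: "0 \<le> energy c F"
  unfolding energy_def by (intro sum_nonneg) auto

lemma continuous_on_wave [continuous_intros]: "continuous_on A (wave \<phi> c F)"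
  unfolding wave_def by (intro continuous_intros)

lemma set_integrable_chi: "A \<in> sets borel \<Longrightarrow> bounded A \<Longrightarrow> set_integrable lborel A (chi l)"
  by (intro set_integrable_continuous_lborel continuous_on_chi)

lemma set_integrable_wave_square:
  "A \<in> sets borel \<Longrightarrow> bounded A \<Longrightarrow> set_integrable lborel A (\<lambda>z. (cmod (wave \<phi> c F z))\<^sup>2)"
  by (intro set_integrable_continuous_lborel continuous_intros)

lemma set_integral_wave_square:
  assumes A: "A \<in> sets borel" "bounded A"
  shows "complex_of_real (LINT z:A|lborel. (cmod (wave \<phi> c F z))\<^sup>2) =
    (\<Sum>(k, l)\<in>F \<times> F. c k * cnj (c l) * (LINT z:A|lborel. chi (k - l, \<phi> k - \<phi> l) z))"
proof -
  have "complex_of_real (LINT z:A|lborel. (cmod (wave \<phi> c F z))\<^sup>2) =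
      (LINT z:A|lborel. complex_of_real ((cmod (wave \<phi> c F z))\<^sup>2))"
    by (rule set_integral_complex_of_real[symmetric])
  also have "(\<lambda>z. complex_of_real ((cmod (wave \<phi> c F z))\<^sup>2)) =
      (\<lambda>z. \<Sum>(k, l)\<in>F \<times> F. c k * cnj (c l) * chi (k - l, \<phi> k - \<phi> l) z)"
  proof
    fix z
    have "complex_of_real ((cmod (wave \<phi> c F z))\<^sup>2) = 
       (\<Sum>(k, l)\<in>F \<times> F. (c k * chi (k, \<phi> k) z) * cnj (c l * chi (l, \<phi> l) z))"
      unfolding complex_norm_square wave_def cnj_sum sum_product by (simp add: sum.cartesian_product)
    also have "\<dots> = (\<Sum>(k, l)\<in>F \<times> F. c k * cnj (c l) * (chi (k, \<phi> k) z * cnj (chi (l, \<phi> l) z)))"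
      by (simp add: mult_ac)
    finally show "complex_of_real ((cmod (wave \<phi> c F z))\<^sup>2) = 
      (\<Sum>(k, l)\<in>F \<times> F. c k * cnj (c l) * chi (k - l, \<phi> k - \<phi> l) z)"
      by (simp add: chi_mult_cnj)
  qed
  also have "(LINT z:A|lborel. (\<Sum>(k, l)\<in>F \<times> F. c k * cnj (c l) * chi (k - l, \<phi> k - \<phi> l) z)) =
    (\<Sum>p\<in>F \<times> F. LINT z:A|lborel. (case p of (k, l) \<Rightarrow> c k * cnj (c l) * chi (k - l, \<phi> k - \<phi> l) z))"
  proof (cases "finite F")
    case True
    have "set_integrable lborel A (\<lambda>z. case p of (k, l) \<Rightarrow> c k * cnj (c l) * chi (k - l, \<phi> k - \<phi> l) z)" for p
      using set_integrable_chi[OF A] by (cases p) simp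
    then show ?thesis
      unfolding set_lebesgue_integral_def set_integrable_def scaleR_sum_right
      by (intro Bochner_Integration.integral_sum) auto
  next
    \<comment> \<open>For infinite \<open>F\<close> both sums are 0 by convention.\<close>
    case False
    have "\<not> finite (F \<times> F)"
      using False by (auto dest: finite_cartesian_productD1)
    then show ?thesis by (simp add: set_lebesgue_integral_def)
  qed
  also have "\<dots> = (\<Sum>(k, l)\<in>F \<times> F. c k * cnj (c l) * (LINT z:A|lborel. chi (k - l, \<phi> k - \<phi> l) z))"
    by (intro sum.cong) auto
  finally show ?thesis .
qed

text \<open>The diagonal of the Gram matrix contributes the main term, and the norm of the rest is
  at most its Hilbert-Schmidt norm. Both signs matter: the lower bound gives observability at high
  frequency, the upper one the smallness on small sets.\<close>

lemma gram_deviation: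
  assumes A: "A \<in> sets borel" "bounded A" and F: "finite F"
  shows "\<bar>(LINT z:A|lborel. (cmod (wave \<phi> c F z))\<^sup>2) - measure lborel A * energy c F\<bar>
     \<le> energy c F * sqrt (sum (gram_offdiag \<phi> A) (F \<times> F - Id))"
proof -
  let ?P = "F \<times> F - Id" and ?L = "LINT z:A|lborel. (cmod (wave \<phi> c F z))\<^sup>2"
  let ?I = "\<lambda>k l. LINT z:A|lborel. chi (k - l, \<phi> k - \<phi> l) z"
  have I0: "?I k k = of_real (measure lborel A)" for k
  proof -
    have "chi (k - k, \<phi> k - \<phi> k) = (\<lambda>z. 1)"
      by (auto simp: chi_def)
    then have "?I k k = (LINT z|lborel. complex_of_real (indicator A z))"
      by (simp add: set_lebesgue_integral_def scaleR_conv_of_real)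
    also have "\<dots> = of_real (measure lborel A)"
      using A by simp
    finally show ?thesis .
  qed
  have diag: "F \<times> F \<inter> Id = (\<lambda>k. (k, k)) ` F"
    by auto
  have "complex_of_real ?L =
      (\<Sum>(k, l)\<in>F \<times> F \<inter> Id. c k * cnj (c l) * ?I k l) + (\<Sum>(k, l)\<in>?P. c k * cnj (c l) * ?I k l)"
    unfolding set_integral_wave_square[OF A] using F by (intro sum.Int_Diff) auto
  also have "(\<Sum>(k, l)\<in>F \<times> F \<inter> Id. c k * cnj (c l) * ?I k l) = (\<Sum>k\<in>F. c k * cnj (c k) * ?I k k)"
    unfolding diag by (subst sum.reindex) (auto simp: inj_on_def)
  also have "\<dots> = complex_of_real (measure lborel A * energy c F)"
    unfolding I0 energy_def by (simp add: sum_distrib_left mult_ac complex_norm_square del: of_real_power)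
  finally have eq: "complex_of_real (?L - measure lborel A * energy c F)
      = (\<Sum>(k, l)\<in>?P. c k * cnj (c l) * ?I k l)"
    by simp
  have "\<bar>?L - measure lborel A * energy c F\<bar> = cmod (complex_of_real (?L - measure lborel A * energy c F))"
    by (rule norm_of_real[symmetric])
  also have "\<dots> = cmod (\<Sum>(k, l)\<in>?P. c k * cnj (c l) * ?I k l)"
    by (simp only: eq)
  also have "\<dots> \<le> (\<Sum>p\<in>?P. cmod (case p of (k, l) \<Rightarrow> c k * cnj (c l) * ?I k l))"
    by (rule norm_sum)
  also have "\<dots> = (\<Sum>p\<in>?P. (cmod (c (fst p)) * cmod (c (snd p))) * cmod (?I (fst p) (snd p)))"
    by (intro sum.cong) (auto simp: norm_mult)
  also have "\<dots> \<le> sqrt (\<Sum>p\<in>?P. (cmod (c (fst p)) * cmod (c (snd p)))\<^sup>2) *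
                  sqrt (\<Sum>p\<in>?P. (cmod (?I (fst p) (snd p)))\<^sup>2)"
    unfolding real_sqrt_mult[symmetric] by (intro real_le_rsqrt Cauchy_Schwarz_ineq_sum)
  also have "\<dots> \<le> energy c F * sqrt (sum (gram_offdiag \<phi> A) ?P)"
  proof (rule mult_mono)
    \<comment> \<open>Putting the diagonal back makes the sum factor into the square of the
      energy.\<close>
    have "(\<Sum>p\<in>?P. (cmod (c (fst p)) * cmod (c (snd p)))\<^sup>2) \<le>
          (\<Sum>p\<in>F \<times> F. (cmod (c (fst p)) * cmod (c (snd p)))\<^sup>2)"
      using F by (intro sum_mono2) auto
    also have "\<dots> = (energy c F)\<^sup>2"
      unfolding energy_def power2_eq_square[of "sum _ _"] sum_product sum.cartesian_product
      by (intro sum.cong) (auto simp: power_mult_distrib)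
    finally show "sqrt (\<Sum>p\<in>?P. (cmod (c (fst p)) * cmod (c (snd p)))\<^sup>2) \<le> energy c F"
      by (intro real_le_lsqrt) (auto simp: energy_nonneg)
    have "(\<Sum>p\<in>?P. (cmod (?I (fst p) (snd p)))\<^sup>2) = sum (gram_offdiag \<phi> A) ?P"
      unfolding gram_offdiag_def by (intro sum.cong) auto
    then show "sqrt (\<Sum>p\<in>?P. (cmod (?I (fst p) (snd p)))\<^sup>2) \<le> sqrt (sum (gram_offdiag \<phi> A) ?P)"
      by simp
  qed (auto simp: energy_nonneg intro: sum_nonneg)
  finally show ?thesis .
qed

text \<open>Pairs are grouped by their frequency difference. Each group has at most \<open>D\<close>
  members with equal Gram entries, and distinct differences are handled by Bessel's inequality. The
  bound does not depend on \<open>F\<close>.\<close>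

lemma sum_gram_offdiag_le:
  assumes A: "A \<in> sets borel" "A \<subseteq> box_at a" and F: "finite F" and D: "sparse_differences \<phi> D"
  shows "sum (gram_offdiag \<phi> A) (F \<times> F - Id) \<le> real D * (4 * pi\<^sup>2 * measure lborel A)"
proof -
  let ?P = "F \<times> F - Id" and ?g = "\<lambda>(k, l). (k - l, \<phi> k - \<phi> l)"
  let ?h = "\<lambda>l. (cmod (LINT z:A|lborel. chi l z))\<^sup>2"
  have fin: "finite ?P"
    using F by auto
  have "sum (gram_offdiag \<phi> A) ?P = (\<Sum>y\<in>?g ` ?P. sum (gram_offdiag \<phi> A) {x. x \<in> ?P \<and> ?g x = y})"
    using fin by (rule sum.image_gen)
  also have "\<dots> \<le> (\<Sum>y\<in>?g ` ?P. real D * ?h y)"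
  proof (rule sum_mono)
    fix y assume "y \<in> ?g ` ?P"
    then obtain k l where "k \<noteq> l" "y = (k - l, \<phi> k - \<phi> l)"
      by auto
    then obtain m n where y: "y = (m, n)" "m \<noteq> 0"
      using right_minus_eq by blast
    let ?S = "{x. x \<in> ?P \<and> ?g x = y}"
    have "sum (gram_offdiag \<phi> A) ?S = (\<Sum>x\<in>?S. ?h y)"
      by (intro sum.cong) (auto simp: gram_offdiag_def)
    also have "\<dots> = real (card ?S) * ?h y"
      by simp
    \<comment> \<open>With the difference \<open>m\<close> fixed, a pair is determined by its second
      entry.\<close>
    also have "card ?S \<le> card {k. \<phi> (k + m) - \<phi> k = n}"
    proof (rule card_inj_on_le)
      show "inj_on snd ?S"
        by (auto simp: inj_on_def y)
      show "snd ` ?S \<subseteq> {k. \<phi> (k + m) - \<phi> k = n}"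
        by (auto simp: y)
      show "finite {k. \<phi> (k + m) - \<phi> k = n}"
        using D y by (auto simp: sparse_differences_def)
    qed
    also have "\<dots> \<le> D"
      using D y by (auto simp: sparse_differences_def)
    finally show "sum (gram_offdiag \<phi> A) ?S \<le> real D * ?h y"
      by (simp add: mult_right_mono)
  qed
  also have "\<dots> \<le> real D * (4 * pi\<^sup>2 * measure lborel A)"
    unfolding sum_distrib_left[symmetric] using fin
    by (intro mult_left_mono bessel_box[OF A]) auto
  finally show ?thesis .
qed

text \<open>The point is that the factor before the energy tends to 0 with the measure of
  \<open>A\<close>, whatever the shape of \<open>A\<close> inside the box.\<close>

lemma wave_square_le:
  assumes A: "A \<in> sets borel" "A \<subseteq> box_at a" and F: "finite F" and D: "sparse_differences \<phi> D"
  shows "(LINT z:A|lborel. (cmod (wave \<phi> c F z))\<^sup>2) \<le>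
     (measure lborel A + sqrt (real D * (4 * pi\<^sup>2 * measure lborel A))) * energy c F"
proof -
  have "(LINT z:A|lborel. (cmod (wave \<phi> c F z))\<^sup>2) \<le>
     measure lborel A * energy c F + energy c F * sqrt (sum (gram_offdiag \<phi> A) (F \<times> F - Id))"
    using gram_deviation[OF A(1) bounded_box_at[OF A(2)] F, of \<phi> c] by linarith
  also have "\<dots> \<le> measure lborel A * energy c F
      + energy c F * sqrt (real D * (4 * pi\<^sup>2 * measure lborel A))"
    using sum_gram_offdiag_le[OF A F D] by (intro add_left_mono mult_left_mono) (auto simp: energy_nonneg)
  finally show ?thesis
    by (simp add: algebra_simps)
qed

text \<open>Smallness of tails of a convergent nonnegative series, phrased with finite sums only:
  \<open>Q\<close> comes within \<open>e\<close> of the supremum, so nothing disjoint from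
  \<open>Q\<close> can add more than \<open>e\<close>.\<close>

lemma finite_sums_small_tail:
  fixes f :: "'a \<Rightarrow> real"
  assumes nonneg: "\<And>x. 0 \<le> f x"
    and bdd: "\<And>Q. finite Q \<Longrightarrow> Q \<subseteq> J \<Longrightarrow> sum f Q \<le> B" and e: "0 < e"
  obtains Q where "finite Q" "Q \<subseteq> J" "\<And>R. finite R \<Longrightarrow> R \<subseteq> J \<Longrightarrow> R \<inter> Q = {} \<Longrightarrow> sum f R \<le> e"
proof -
  let ?X = "sum f ` {Q. finite Q \<and> Q \<subseteq> J}"
  have ne: "?X \<noteq> {}" by blast
  have bd: "bdd_above ?X"
    using bdd by (auto simp: bdd_above_def)
  have "Sup ?X - e < Sup ?X"
    using e by simp
  then obtain Q where Q: "finite Q" "Q \<subseteq> J" "Sup ?X - e < sum f Q"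
    using less_cSup_iff[OF ne bd] by auto
  show ?thesis
  proof (rule that[OF Q(1,2)])
    fix R assume R: "finite R" "R \<subseteq> J" "R \<inter> Q = {}"
    have "sum f (R \<union> Q) \<le> Sup ?X"
      using Q R by (intro cSup_upper bd) auto
    then show "sum f R \<le> e"
      using Q R by (simp add: sum.union_disjoint)
  qed
qed

lemma observable_high_frequency:
  assumes A: "A \<in> sets borel" "A \<subseteq> box_at a" "0 < measure lborel A"
    and D: "sparse_differences \<phi> D"
  obtains K where "finite K" "observable \<phi> A K"
proof -
  let ?m = "measure lborel A" and ?f = "gram_offdiag \<phi> A"
  have nonneg: "0 \<le> ?f x" for x
    by (auto simp: gram_offdiag_def split: prod.split)
  have "sum ?f Q \<le> real D * (4 * pi\<^sup>2 * ?m)" if "finite Q" "Q \<subseteq> - Id" for Q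
  proof -
    \<comment> \<open>Any finite set of off-diagonal pairs lies in a square
      \<open>?F \<times> ?F\<close>, where the uniform bound applies.\<close>
    let ?F = "fst ` Q \<union> snd ` Q"
    have "sum ?f Q \<le> sum ?f (?F \<times> ?F - Id)"
    proof (rule sum_mono2)
      show "Q \<subseteq> ?F \<times> ?F - Id"
        using that(2) by (force simp: image_iff)
    qed (use that nonneg in auto)
    also have "\<dots> \<le> real D * (4 * pi\<^sup>2 * ?m)"
      using that by (intro sum_gram_offdiag_le[OF A(1,2) _ D]) auto
    finally show ?thesis .
  qed
  \<comment> \<open>The deviation involves a square root, so this tolerance costs half of the
    diagonal value \<open>?m\<close> and leaves the constant \<open>?m / 2\<close>.\<close>
  moreover have "0 < (?m / 2)\<^sup>2"
    using A by simp
  ultimately obtain Q where Q: "finite Q"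
    "\<And>R. finite R \<Longrightarrow> R \<subseteq> - Id \<Longrightarrow> R \<inter> Q = {} \<Longrightarrow> sum ?f R \<le> (?m / 2)\<^sup>2"
    using nonneg finite_sums_small_tail[of ?f "- Id" "real D * (4 * pi\<^sup>2 * ?m)" "(?m / 2)\<^sup>2"] by metis
  \<comment> \<open>Removing the first entries is enough: a pair from \<open>F \<times> F\<close>
    with \<open>F\<close> disjoint from \<open>?K\<close> cannot belong to \<open>Q\<close>.\<close>
  let ?K = "fst ` Q"
  have "?m / 2 * energy c F \<le> (LINT z:A|lborel. (cmod (wave \<phi> c F z))\<^sup>2)"
    if F: "finite F" "F \<inter> ?K = {}" for c F
  proof -
    have "sum ?f (F \<times> F - Id) \<le> (?m / 2)\<^sup>2"
    proof (rule Q(2))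
      have "k \<notin> F" if "(k, l) \<in> Q" for k l
        using F(2) that by (metis disjoint_iff fst_conv image_eqI)
      then show "(F \<times> F - Id) \<inter> Q = {}"
        by auto
    qed (use F in auto)
    then have "sqrt (sum ?f (F \<times> F - Id)) \<le> ?m / 2"
      using A by (intro real_le_lsqrt) (auto intro: sum_nonneg nonneg)
    then have "energy c F * sqrt (sum ?f (F \<times> F - Id)) \<le> energy c F * (?m / 2)"
      by (intro mult_left_mono energy_nonneg)
    moreover have "?m * energy c F = ?m / 2 * energy c F + energy c F * (?m / 2)"
      by simp
    ultimately show ?thesis
      using gram_deviation[OF A(1) bounded_box_at[OF A(2)] F(1), of \<phi> c] by linarith
  qed
  then have "observable \<phi> A ?K"
    unfolding observable_def using A by (intro exI[of _ "?m / 2"]) auto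
  then show ?thesis
    using Q(1) by (intro that[of ?K]) simp_all
qed

section \<open>Observability for finite sums of exponentials\<close>

lemma sin_less_self:
  fixes y :: real
  assumes "0 < y"
  shows "sin y < y"
proof (cases "y \<le> 1")
  case False
  then show ?thesis using sin_le_one[of y] by linarith
next
  case True
  have "(\<lambda>x. x - sin x) 0 < (\<lambda>x. x - sin x) y"
  proof (rule DERIV_pos_imp_increasing_open[OF assms])
    fix x assume x: "0 < x" "x < y"
    have "cos x < cos 0"
      using x True pi_ge_two by (intro cos_monotone_0_pi) auto
    moreover have "((\<lambda>x. x - sin x) has_real_derivative 1 - cos x) (at x)"
      by (auto intro!: derivative_eq_intros)
    ultimately show "\<exists>d. ((\<lambda>x. x - sin x) has_real_derivative d) (at x) \<and> 0 < d"
      by (intro exI[of _ "1 - cos x"]) auto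
  qed (auto intro!: continuous_intros)
  then show ?thesis by simp
qed

text \<open>With \<open>m = k - k0\<close> the integrand is the squared distance of the phases
  \<open>cis (k h)\<close> and \<open>cis (k0 h)\<close>. Its integral is positive for each
  \<open>m \<noteq> 0\<close> since \<open>sin y < y\<close> for positive \<open>y\<close>, and at
  least \<open>\<eta>\<close> for large \<open>\<bar>m\<bar>\<close>, so a minimum over finitely
  many values remains.\<close>

lemma averaged_phase_difference:
  fixes \<eta> :: real
  assumes \<eta>: "0 < \<eta>"
  obtains \<delta> where "0 < \<delta>"
    "\<And>m::int. m \<noteq> 0 \<Longrightarrow> \<exists>J\<ge>\<delta>. ((\<lambda>h. 2 - 2 * cos (of_int m * h)) has_integral J) {0..\<eta>}"
proof -
  let ?J = "\<lambda>m::int. 2 * \<eta> - 2 * sin (of_int m * \<eta>) / of_int m"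
  have J: "((\<lambda>h. 2 - 2 * cos (of_int m * h)) has_integral ?J m) {0..\<eta>}" if "m \<noteq> 0" for m
  proof -
    have "((\<lambda>h. 2 - 2 * cos (of_int m * h)) has_integral
       (2 * \<eta> - 2 * sin (of_int m * \<eta>) / of_int m) - (2 * 0 - 2 * sin (of_int m * 0) / of_int m)) {0..\<eta>}"
      using \<eta> that
      by (intro fundamental_theorem_of_calculus)
        (auto intro!: derivative_eq_intros simp: has_real_derivative_iff_has_vector_derivative[symmetric])
    then show ?thesis by simp
  qed
  have pos: "0 < ?J m" if "m \<noteq> 0" for m
  proof (cases "0 < m")
    case True
    then show ?thesis
      using sin_less_self[of "of_int m * \<eta>"] \<eta> by (simp add: field_simps)
  next
    case False
    then show ?thesis
      using sin_less_self[of "- of_int m * \<eta>"] \<eta> that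
      by (simp add: field_simps mult_pos_neg)
  qed
  \<comment> \<open>From this cutoff on, \<open>2 * sin (m * \<eta>) / m\<close> is at most
    \<open>\<eta>\<close> in modulus, half of the main term \<open>2 * \<eta>\<close>. The element
    \<open>\<eta>\<close> of \<open>S\<close> takes care of all \<open>m\<close> beyond it.\<close>
  define N where "N = \<lceil>2 / \<eta>\<rceil>"
  define S where "S = insert \<eta> (?J ` ({-N..N} - {0}))"
  have S: "finite S" "S \<noteq> {}"
    unfolding S_def by auto
  show ?thesis
  proof (rule that[of "Min S"])
    show "0 < Min S"
      using \<eta> pos by (subst Min_gr_iff[OF S]) (auto simp: S_def)
    fix m :: int assume m: "m \<noteq> 0"
    have "Min S \<le> ?J m"
    proof (cases "m \<in> {-N..N}")
      case True
      with m show ?thesis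
        by (intro Min_le S) (auto simp: S_def)
    next
      case False
      then have "N \<le> \<bar>m\<bar>"
        by auto
      then have "2 / \<eta> \<le> of_int \<bar>m\<bar>"
        unfolding N_def by (simp add: ceiling_le_iff)
      then have "2 / \<eta> \<le> \<bar>of_int m\<bar>"
        by simp
      then have "2 \<le> \<eta> * \<bar>of_int m\<bar>"
        using \<eta> by (simp add: field_simps)
      then have "2 * \<bar>sin (of_int m * \<eta>)\<bar> \<le> \<eta> * \<bar>of_int m\<bar>"
        using abs_sin_le_one[of "of_int m * \<eta>"] by linarith
      then have "\<bar>2 * sin (of_int m * \<eta>) / of_int m\<bar> \<le> \<eta>"
        using m by (simp add: abs_mult field_simps)
      then have "\<eta> \<le> ?J m" by linarith
      moreover have "Min S \<le> \<eta>"
        by (intro Min_le S) (auto simp: S_def)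
      ultimately show ?thesis by linarith
    qed
    then show "\<exists>J\<ge>Min S. ((\<lambda>h. 2 - 2 * cos (of_int m * h)) has_integral J) {0..\<eta>}"
      using J[OF m] by blast
  qed
qed

text \<open>For small \<open>v\<close> the translate of \<open>G\<close> stays in an open
  \<open>U\<close> that exceeds \<open>G\<close> by less than \<open>e\<close>. A point leaving
  \<open>G\<close> thus lands in \<open>U - G\<close>, and Lebesgue measure is translation
  invariant. Compactness makes \<open>\<eta>\<close> uniform over \<open>G\<close>.\<close>

lemma compact_shift_measure:
  fixes G :: "'a::euclidean_space set"
  assumes G: "compact G" and e: "0 < e"
  obtains \<eta> where "0 < \<eta>" "\<And>v. norm v \<le> \<eta> \<Longrightarrow> measure lborel (G - {z. z + v \<in> G}) \<le> e"
proof -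
  have "G \<in> sets lebesgue"
    using G by (simp add: lmeasurable_compact fmeasurableD)
  then obtain U where U: "open U" "G \<subseteq> U" "U - G \<in> lmeasurable" "emeasure lebesgue (U - G) < ennreal e"
    using e by (rule sets_lebesgue_outer_open)
  obtain \<eta> where \<eta>: "0 < \<eta>" "(\<Union>x\<in>G. cball x \<eta>) \<subseteq> U"
    using compact_subset_open_imp_cball_epsilon_subset[OF G U(1,2)] .
  have Gb: "G \<in> sets borel"
    using G by (simp add: borel_compact)
  have "measure lborel (G - {z. z + v \<in> G}) \<le> e" if v: "norm v \<le> \<eta>" for v
  proof -
    have "emeasure lborel (G - {z. z + v \<in> G}) \<le> emeasure lborel ((\<lambda>z. v + z) -` (U - G))"
    proof (rule emeasure_mono)
      have "z + v \<in> U" if "z \<in> G" for z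
      proof -
        have "z + v \<in> cball z \<eta>"
          using v by (simp add: dist_norm)
        then show ?thesis using \<eta>(2) that by blast
      qed
      then show "G - {z. z + v \<in> G} \<subseteq> (\<lambda>z. v + z) -` (U - G)"
        by (auto simp: add.commute)
      show "(\<lambda>z. v + z) -` (U - G) \<in> sets lborel"
        using measurable_sets_borel[of "\<lambda>z. v + z" borel "U - G"] U Gb by simp
    qed
    also have "\<dots> = emeasure (distr lborel borel ((+) v)) (U - G)"
      using U Gb by (subst emeasure_distr) auto
    also have "\<dots> = emeasure lebesgue (U - G)"
      unfolding lborel_distr_plus using U Gb by simp
    also have "\<dots> \<le> ennreal e"
      using U by simp
    finally show ?thesis
      unfolding measure_def using e by (simp add: enn2real_leI)
  qed
  then show ?thesis
    using that \<eta> by blast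
qed

lemma set_integral_subset_mono:
  fixes f :: "'a \<Rightarrow> real"
  assumes f: "set_integrable M B f" and A: "A \<in> sets M" "A \<subseteq> B" and nonneg: "\<And>x. x \<in> B \<Longrightarrow> 0 \<le> f x"
  shows "(LINT x:A|M. f x) \<le> (LINT x:B|M. f x)"
  using set_integrable_subset[OF f A] f A(2) nonneg
  unfolding set_lebesgue_integral_def set_integrable_def
  by (intro integral_mono) (auto simp: indicator_def)

lemma set_integral_shift_le:
  fixes f :: "'a::euclidean_space \<Rightarrow> real"
  assumes G: "G \<in> sets borel" and f: "set_integrable lborel G f" and nonneg: "\<And>z. 0 \<le> f z"
    and f': "set_integrable lborel (G \<inter> {z. z + v \<in> G}) (\<lambda>z. f (z + v))"
  shows "(LINT z:G \<inter> {z. z + v \<in> G}|lborel. f (z + v)) \<le> (LINT z:G|lborel. f z)"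
proof -
  define g where "g z = indicator G z *\<^sub>R f z" for z
  have g: "integrable lborel g"
    using f unfolding set_integrable_def g_def .
  then have g_meas: "g \<in> borel_measurable borel"
    using borel_measurable_integrable[OF g] by simp
  have "integrable (distr lborel borel ((+) v)) g"
    unfolding lborel_distr_plus by (rule g)
  then have sh: "integrable lborel (\<lambda>z. g (v + z))"
    by (subst (asm) integrable_distr_eq) (simp_all add: g_meas)
  have "(LINT z:G \<inter> {z. z + v \<in> G}|lborel. f (z + v)) \<le> (LINT z|lborel. g (v + z))"
    unfolding set_lebesgue_integral_def
  proof (rule integral_mono)
    show "integrable lborel (\<lambda>z. indicator (G \<inter> {z. z + v \<in> G}) z *\<^sub>R f (z + v))"
      using f' unfolding set_integrable_def .
    show "indicator (G \<inter> {z. z + v \<in> G}) z *\<^sub>R f (z + v) \<le> g (v + z)" for z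
      using nonneg[of "v + z"] by (simp add: g_def indicator_def add.commute)
  qed (rule sh)
  also have "\<dots> = integral\<^sup>L (distr lborel borel ((+) v)) g"
    by (rule integral_distr[symmetric]) (simp_all add: g_meas)
  also have "\<dots> = (LINT z:G|lborel. f z)"
    unfolding lborel_distr_plus set_lebesgue_integral_def g_def ..
  finally show ?thesis .
qed

section \<open>Restoring one discarded frequency\<close>

text \<open>Translation by \<open>h\<close> in \<open>x\<close> multiplies the
  \<open>k\<close>-component by \<open>cis (k h)\<close>, so the difference loses \<open>k0\<close>
  for every \<open>h\<close> and becomes a wave to which observability off \<open>k0\<close>
  applies.\<close>

lemma wave_shift_difference:
  assumes "finite F"
  shows "wave \<phi> a F (z + (0, h)) - cis (of_int k0 * h) * wave \<phi> a F z
     = wave \<phi> (\<lambda>k. a k * (cis (of_int k * h) - cis (of_int k0 * h))) (F - {k0}) z"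
proof -
  have "wave \<phi> a F (z + (0, h)) - cis (of_int k0 * h) * wave \<phi> a F z =
    (\<Sum>k\<in>F. a k * (cis (of_int k * h) - cis (of_int k0 * h)) * chi (k, \<phi> k) z)"
    unfolding wave_def sum_distrib_left sum_subtractf[symmetric]
    by (intro sum.cong) (auto simp: chi_def cis_mult[symmetric] algebra_simps)
  also have "\<dots> = (\<Sum>k\<in>F - {k0}. a k * (cis (of_int k * h) - cis (of_int k0 * h)) * chi (k, \<phi> k) z)"
    using assms by (intro sum.mono_neutral_right) auto
  finally show ?thesis
    by (simp add: wave_def)
qed

lemma cmod_cis_diff_square: "(cmod (cis x - cis y))\<^sup>2 = 2 - 2 * cos (x - y)"
proof -
  have "(cmod (cis x - cis y))\<^sup>2 = (cos x)\<^sup>2 + (sin x)\<^sup>2 + ((cos y)\<^sup>2 + (sin y)\<^sup>2) - 2 * (cos x * cos y + sin x * sin y)"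
    unfolding cmod_power2 by (simp add: power2_eq_square algebra_simps)
  then show ?thesis
    by (simp add: cos_diff)
qed

lemma cmod_diff_square_le: "(cmod (x - y))\<^sup>2 \<le> 2 * (cmod x)\<^sup>2 + 2 * (cmod y)\<^sup>2"
proof -
  have "(cmod (x - y))\<^sup>2 \<le> (cmod x + cmod y)\<^sup>2"
    by (intro power_mono norm_triangle_ineq4) auto
  also have "\<dots> \<le> 2 * (cmod x)\<^sup>2 + 2 * (cmod y)\<^sup>2"
    using zero_le_power2[of "cmod x - cmod y"] by (simp add: power2_eq_square algebra_simps)
  finally show ?thesis .
qed

text \<open>The factor \<open>\<bar>e\<^bsup>i k h\<^esup> - e\<^bsup>i k0 h\<^esup>\<bar>\<close> produced by one shift \<open>h\<close> can be arbitrarily small;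
  its mean square over \<open>0 \<le> h \<le> \<eta>\<close> is bounded below uniformly in \<open>k \<noteq> k0\<close>.\<close>

lemma observable_remove_point:
  assumes G: "compact G" "G \<subseteq> box_at a0" "0 < measure lborel G"
    and D: "sparse_differences \<phi> D" and obs: "observable \<phi> G (insert k0 K)"
  shows "observable \<phi> G K"
proof -
  have Gb: "G \<in> sets borel" "bounded G"
    using G by (auto simp: borel_compact compact_imp_bounded)
  \<comment> \<open>The factor of \<open>wave_square_le\<close> as a function of the measure:
    increasing on nonnegative reals and tending to 0 at 0.\<close>
  define \<kappa> where "\<kappa> s = s + sqrt (real D * (4 * pi\<^sup>2 * s))" for s
  have \<kappa>_mono: "\<kappa> s \<le> \<kappa> t" if "s \<le> t" for s t
    unfolding \<kappa>_def using that by (intro add_mono real_sqrt_le_mono mult_left_mono) auto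
  have upper: "(LINT z:A|lborel. (cmod (wave \<phi> c F z))\<^sup>2) \<le> \<kappa> (measure lborel A) * energy c F"
    if "A \<in> sets borel" "A \<subseteq> G" "finite F" for A c F
    unfolding \<kappa>_def using that G by (intro wave_square_le D) auto
  obtain c where c: "0 < c" "\<And>a F. finite F \<Longrightarrow> F \<inter> insert k0 K = {} \<Longrightarrow>
      c * energy a F \<le> (LINT z:G|lborel. (cmod (wave \<phi> a F z))\<^sup>2)"
    using obs unfolding observable_def by blast
  \<comment> \<open>On a set of measure at most \<open>e\<close> a wave carries at most half of what
    the observability constant \<open>c\<close> guarantees on \<open>G\<close>, so that part can be
    absorbed on the left.\<close>
  obtain e where e: "0 < e" "\<kappa> e \<le> c / 2"
  proof -
    have "((\<lambda>s. s + sqrt (real D * (4 * pi\<^sup>2 * s))) \<longlongrightarrow> 0 + sqrt (real D * (4 * pi\<^sup>2 * 0))) (at_right 0)"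
      by (intro tendsto_intros)
    then have "(\<kappa> \<longlongrightarrow> 0) (at_right 0)"
      by (simp add: \<kappa>_def[abs_def])
    then have "\<forall>\<^sub>F s in at_right 0. \<kappa> s < c / 2"
      using c(1) by (intro order_tendstoD) auto
    moreover have "\<forall>\<^sub>F s::real in at_right 0. 0 < s"
      by (simp add: eventually_at_right_less)
    ultimately have "\<forall>\<^sub>F s in at_right 0. 0 < s \<and> \<kappa> s < c / 2"
      by eventually_elim auto
    then obtain s where "0 < s" "\<kappa> s < c / 2"
      using eventually_happens[of _ "at_right (0::real)"] by (auto simp: trivial_limit_at_right_real)
    then show ?thesis using that by fastforce
  qed
  obtain \<eta> where \<eta>: "0 < \<eta>" "\<And>v. norm v \<le> \<eta> \<Longrightarrow> measure lborel (G - {z. z + v \<in> G}) \<le> e"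
    using compact_shift_measure[OF G(1) e(1)] by blast
  obtain \<delta> where \<delta>: "0 < \<delta>"
    "\<And>m::int. m \<noteq> 0 \<Longrightarrow> \<exists>J\<ge>\<delta>. ((\<lambda>h. 2 - 2 * cos (of_int m * h)) has_integral J) {0..\<eta>}"
    using averaged_phase_difference[OF \<eta>(1)] by blast
  \<comment> \<open>For each \<open>h\<close> the weighted energy is at most
    \<open>8 * ?A / c\<close>. Integration over \<open>{0..\<eta>}\<close> gives the factor
    \<open>\<eta>\<close>, and each weight then integrates to at least
    \<open>\<delta>\<close>.\<close>
  define M where "M = 8 * \<eta> / (c * \<delta>)"
  have M: "0 \<le> M"
    unfolding M_def using \<eta> c \<delta> by simp
  have other: "energy a (F - {k0}) \<le> M * (LINT z:G|lborel. (cmod (wave \<phi> a F z))\<^sup>2)"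
    if F: "finite F" "F \<inter> K = {}" for a F
  proof -
    let ?A = "LINT z:G|lborel. (cmod (wave \<phi> a F z))\<^sup>2" and ?F = "F - {k0}"
    \<comment> \<open>On \<open>G \<inter> ?H\<close> both \<open>z\<close> and its translate lie in
      \<open>G\<close>, so the difference costs at most \<open>4 * ?A\<close>. The rest
      \<open>G - ?H\<close> has small measure and costs at most \<open>c / 2\<close> times the
      energy of \<open>?b\<close>. Absorbing it turns 4 into 8.\<close>
    have pointwise: "(\<Sum>k\<in>?F. (cmod (a k))\<^sup>2 * (2 - 2 * cos (of_int (k - k0) * h))) \<le> 8 * ?A / c"
      if h: "h \<in> {0..\<eta>}" for h
    proof -
      let ?v = "(0, h) :: real \<times> real" and ?b = "\<lambda>k. a k * (cis (of_int k * h) - cis (of_int k0 * h))"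
      let ?H = "{z. z + ?v \<in> G}" and ?w = "\<lambda>z. (cmod (wave \<phi> ?b ?F z))\<^sup>2"
      have "?H = (\<lambda>z. z + ?v) -` G" by auto
      then have H: "?H \<in> sets borel"
        using measurable_sets_borel[of "\<lambda>z. z + ?v" borel G] Gb by simp
      have bd: "bounded (G \<inter> ?H)" "bounded (G - ?H)"
        using Gb(2) by (auto intro: bounded_subset)
      have meas: "G \<inter> ?H \<in> sets borel" "G - ?H \<in> sets borel"
        using Gb H by auto
      have cont: "continuous_on UNIV (\<lambda>z. (cmod (wave \<phi> a F (z + ?v)))\<^sup>2)"
        by (intro continuous_intros continuous_on_compose2[OF continuous_on_wave[of UNIV]]) auto
      have "c * energy ?b ?F \<le> (LINT z:G|lborel. ?w z)"
        using F by (intro c(2)) auto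
      also have "(LINT z:G|lborel. ?w z) = (LINT z:(G \<inter> ?H) \<union> (G - ?H)|lborel. ?w z)"
        by (simp add: Int_Diff_Un)
      also have "\<dots> = (LINT z:G \<inter> ?H|lborel. ?w z) + (LINT z:G - ?H|lborel. ?w z)"
        by (intro set_integral_Un set_integrable_wave_square meas bd) auto
      finally have 1: "c * energy ?b ?F \<le> (LINT z:G \<inter> ?H|lborel. ?w z) + (LINT z:G - ?H|lborel. ?w z)" .
      have 2: "(LINT z:G \<inter> ?H|lborel. ?w z) \<le>
          (LINT z:G \<inter> ?H|lborel. 2 * (cmod (wave \<phi> a F (z + ?v)))\<^sup>2 + 2 * (cmod (wave \<phi> a F z))\<^sup>2)"
      proof (rule set_integral_mono)
        show "set_integrable lborel (G \<inter> ?H)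
            (\<lambda>z. 2 * (cmod (wave \<phi> a F (z + ?v)))\<^sup>2 + 2 * (cmod (wave \<phi> a F z))\<^sup>2)"
          by (intro set_integrable_continuous_lborel meas bd continuous_intros cont)
        fix z
        show "?w z \<le> 2 * (cmod (wave \<phi> a F (z + ?v)))\<^sup>2 + 2 * (cmod (wave \<phi> a F z))\<^sup>2"
          using cmod_diff_square_le[of "wave \<phi> a F (z + ?v)" "cis (of_int k0 * h) * wave \<phi> a F z"]
          unfolding wave_shift_difference[OF F(1)] by (simp add: norm_mult)
      qed (intro set_integrable_wave_square meas bd)
      have 3: "(LINT z:G \<inter> ?H|lborel. 2 * (cmod (wave \<phi> a F (z + ?v)))\<^sup>2 + 2 * (cmod (wave \<phi> a F z))\<^sup>2)
         = 2 * (LINT z:G \<inter> ?H|lborel. (cmod (wave \<phi> a F (z + ?v)))\<^sup>2)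
           + 2 * (LINT z:G \<inter> ?H|lborel. (cmod (wave \<phi> a F z))\<^sup>2)"
      proof -
        have "set_integrable lborel (G \<inter> ?H) (\<lambda>z. (cmod (wave \<phi> a F (z + ?v)))\<^sup>2)"
          by (intro set_integrable_continuous_lborel meas bd cont)
        moreover have "set_integrable lborel (G \<inter> ?H) (\<lambda>z. (cmod (wave \<phi> a F z))\<^sup>2)"
          by (intro set_integrable_wave_square meas bd)
        ultimately show ?thesis
          by (subst set_integral_add) auto
      qed
      have 4: "(LINT z:G \<inter> ?H|lborel. (cmod (wave \<phi> a F (z + ?v)))\<^sup>2) \<le> ?A"
        by (intro set_integral_shift_le set_integrable_wave_square Gb set_integrable_continuous_lborel
             meas bd cont) auto
      have 5: "(LINT z:G \<inter> ?H|lborel. (cmod (wave \<phi> a F z))\<^sup>2) \<le> ?A"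
        by (intro set_integral_subset_mono set_integrable_wave_square Gb) (use meas in auto)
      have 6: "(LINT z:G - ?H|lborel. ?w z) \<le> c / 2 * energy ?b ?F"
      proof -
        have "(LINT z:G - ?H|lborel. ?w z) \<le> \<kappa> (measure lborel (G - ?H)) * energy ?b ?F"
          using F meas by (intro upper) auto
        also have "\<dots> \<le> c / 2 * energy ?b ?F"
        proof (rule mult_right_mono[OF _ energy_nonneg])
          show "\<kappa> (measure lborel (G - ?H)) \<le> c / 2"
            using \<kappa>_mono[OF \<eta>(2)[of ?v]] h e(2) by (auto simp: norm_Pair)
        qed
        finally show ?thesis .
      qed
      have "c * energy ?b ?F \<le> 8 * ?A"
        using 1 2 4 5 6 unfolding 3 by argo
      moreover have "energy ?b ?F = (\<Sum>k\<in>?F. (cmod (a k))\<^sup>2 * (2 - 2 * cos (of_int (k - k0) * h)))"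
        unfolding energy_def
        by (intro sum.cong) (simp_all add: norm_mult power_mult_distrib cmod_cis_diff_square left_diff_distrib)
      ultimately show ?thesis
        using c(1) by (simp add: field_simps)
    qed
    have "\<forall>k. \<exists>J. k \<noteq> k0 \<longrightarrow> \<delta> \<le> J \<and>
        ((\<lambda>h. 2 - 2 * cos (of_int (k - k0) * h)) has_integral J) {0..\<eta>}"
      using \<delta>(2) by (metis right_minus_eq)
    then obtain J where J: "\<And>k. k \<noteq> k0 \<Longrightarrow> \<delta> \<le> J k"
      "\<And>k. k \<noteq> k0 \<Longrightarrow> ((\<lambda>h. 2 - 2 * cos (of_int (k - k0) * h)) has_integral J k) {0..\<eta>}"
      by metis
    have "\<delta> * energy a ?F \<le> (\<Sum>k\<in>?F. (cmod (a k))\<^sup>2 * J k)"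
      unfolding energy_def sum_distrib_left
      by (intro sum_mono) (auto simp: mult.commute[of \<delta>] intro!: mult_left_mono J)
    also have "\<dots> \<le> (8 * ?A / c) * \<eta>"
    proof (rule has_integral_le)
      show "((\<lambda>h. \<Sum>k\<in>?F. (cmod (a k))\<^sup>2 * (2 - 2 * cos (of_int (k - k0) * h))) has_integral
          (\<Sum>k\<in>?F. (cmod (a k))\<^sup>2 * J k)) {0..\<eta>}"
        using F by (intro has_integral_sum has_integral_mult_right J) auto
      show "((\<lambda>h. 8 * ?A / c) has_integral (8 * ?A / c) * \<eta>) {0..\<eta>}"
        using has_integral_const_real[of "8 * ?A / c" 0 \<eta>] \<eta> by (simp add: mult.commute)
    qed (use pointwise in auto)
    finally show ?thesis
      using \<delta>(1) c(1) by (simp add: M_def field_simps)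
  qed
  let ?m = "measure lborel G"
  \<comment> \<open>\<open>M\<close> accounts for the frequencies other than \<open>k0\<close>; the
    quotient bounds the \<open>k0\<close> coefficient, once the other frequencies are subtracted
    from the wave and estimated by \<open>\<kappa> ?m * M\<close>.\<close>
  define B where "B = M + (2 + 2 * \<kappa> ?m * M) / ?m"
  have \<kappa>_nonneg: "0 \<le> \<kappa> ?m"
    by (simp add: \<kappa>_def)
  have B: "0 < B"
  proof -
    have "0 \<le> \<kappa> ?m * M"
      using \<kappa>_nonneg M by simp
    then have "0 < (2 + 2 * \<kappa> ?m * M) / ?m"
      using G(3) by (intro divide_pos_pos) linarith+
    then show ?thesis
      unfolding B_def using M by linarith
  qed
  have "energy a F \<le> B * (LINT z:G|lborel. (cmod (wave \<phi> a F z))\<^sup>2)"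
    if F: "finite F" "F \<inter> K = {}" for a F
  proof -
    let ?A = "LINT z:G|lborel. (cmod (wave \<phi> a F z))\<^sup>2" and ?F = "F - {k0}"
    have A0: "0 \<le> ?A"
      unfolding set_lebesgue_integral_def by (intro integral_nonneg_AE) auto
    show ?thesis
    proof (cases "k0 \<in> F")
      case False
      then have "energy a F \<le> M * ?A"
        using other[OF F, of a] by simp
      also have "\<dots> \<le> B * ?A"
        using A0 \<kappa>_nonneg M by (intro mult_right_mono) (auto simp: B_def)
      finally show ?thesis .
    next
      case True
      have split: "wave \<phi> a F z = a k0 * chi (k0, \<phi> k0) z + wave \<phi> a ?F z" for z
        unfolding wave_def using F True by (simp add: sum.remove)
      have energy: "energy a F = (cmod (a k0))\<^sup>2 + energy a ?F"
        unfolding energy_def using F True by (simp add: sum.remove)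
      \<comment> \<open>Since \<open>chi\<close> has modulus one, the \<open>k0\<close> component
        has constant modulus and can be integrated over \<open>G\<close> exactly.\<close>
      have le: "(cmod (a k0))\<^sup>2 \<le> 2 * (cmod (wave \<phi> a F z))\<^sup>2 + 2 * (cmod (wave \<phi> a ?F z))\<^sup>2" for z
        using cmod_diff_square_le[of "wave \<phi> a F z" "wave \<phi> a ?F z"]
        by (simp add: split norm_mult)
      have "(cmod (a k0))\<^sup>2 * ?m = (LINT z:G|lborel. (cmod (a k0))\<^sup>2)"
        using Gb G(1) by (simp add: set_lebesgue_integral_def mult.commute)
      also have "\<dots> \<le> (LINT z:G|lborel. 2 * (cmod (wave \<phi> a F z))\<^sup>2 + 2 * (cmod (wave \<phi> a ?F z))\<^sup>2)"
        by (intro set_integral_mono le set_integrable_continuous_lborel Gb continuous_intros)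
      also have "\<dots> = 2 * ?A + 2 * (LINT z:G|lborel. (cmod (wave \<phi> a ?F z))\<^sup>2)"
        using set_integrable_wave_square[OF Gb, of \<phi> a F] set_integrable_wave_square[OF Gb, of \<phi> a ?F]
        by (subst set_integral_add) auto
      finally have 1: "(cmod (a k0))\<^sup>2 * ?m \<le> 2 * ?A + 2 * (LINT z:G|lborel. (cmod (wave \<phi> a ?F z))\<^sup>2)" .
      have 2: "(LINT z:G|lborel. (cmod (wave \<phi> a ?F z))\<^sup>2) \<le> \<kappa> ?m * energy a ?F"
        using F Gb by (intro upper) auto
      have 3: "\<kappa> ?m * energy a ?F \<le> \<kappa> ?m * (M * ?A)"
        using other[OF F] \<kappa>_nonneg by (rule mult_left_mono)
      have "(cmod (a k0))\<^sup>2 * ?m \<le> (2 + 2 * \<kappa> ?m * M) * ?A"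
        using 1 2 3 by (simp add: algebra_simps)
      then have "(cmod (a k0))\<^sup>2 \<le> (2 + 2 * \<kappa> ?m * M) / ?m * ?A"
        using G(3) by (simp add: field_simps)
      with other[OF F, of a] show ?thesis
        unfolding energy B_def distrib_right by linarith
    qed
  qed
  then have "\<forall>a F. finite F \<longrightarrow> F \<inter> K = {} \<longrightarrow>
      1 / B * energy a F \<le> (LINT z:G|lborel. (cmod (wave \<phi> a F z))\<^sup>2)"
    using B by (auto simp: field_simps)
  then show ?thesis
    unfolding observable_def using B by (intro exI[of _ "1 / B"]) auto
qed

lemma observable_compact:
  assumes G: "compact G" "G \<subseteq> box_at a0" "0 < measure lborel G" and D: "sparse_differences \<phi> D"
  shows "observable \<phi> G {}"
proof -
  have "G \<in> sets borel"
    using G by (simp add: borel_compact)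
  then obtain K where "finite K" "observable \<phi> G K"
    using observable_high_frequency[OF _ G(2,3) D] by blast
  then show ?thesis
    by (induction K rule: finite_induct) (use observable_remove_point[OF G D] in blast)+
qed

text \<open>The solutions \<open>k\<close> are the roots of p(x + m) - p(x) - n, of degree at most
  that of \<open>p\<close>. If this polynomial vanished, \<open>p\<close> would be affine along the
  progression of multiples of \<open>m\<close>, hence affine, against the degree assumption.\<close>

lemma sparse_differences_poly:
  fixes p :: "int poly"
  assumes "degree p \<ge> 2"
  shows "sparse_differences (poly p) (degree p)"
  unfolding sparse_differences_def
proof (intro allI impI)
  fix m n :: int assume m: "m \<noteq> 0"
  let ?q = "pcompose p [:m, 1:] - p - [:n:]"
  have "?q \<noteq> 0"
  proof
    assume q: "?q = 0"
    have step: "poly p (x + m) = poly p x + n" for x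
      using arg_cong[OF q, of "\<lambda>q. poly q x"] by (simp add: poly_pcompose algebra_simps)
    have "poly p (of_nat j * m) = poly p 0 + of_nat j * n" for j
    proof (induction j)
      case (Suc j)
      then show ?case
        using step[of "of_nat j * m"] by (simp add: algebra_simps)
    qed simp
    then have roots: "poly (pcompose p [:0, m:] - [:poly p 0, n:]) (of_nat j) = 0" for j
      by (simp add: poly_pcompose)
    \<comment> \<open>Two polynomials that agree at all natural numbers coincide; since
      \<open>m \<noteq> 0\<close>, rescaling the variable keeps the degree of
      \<open>p\<close>.\<close>
    have "pcompose p [:0, m:] = [:poly p 0, n:]"
    proof (rule ccontr)
      assume "pcompose p [:0, m:] \<noteq> [:poly p 0, n:]"
      then have "finite {x. poly (pcompose p [:0, m:] - [:poly p 0, n:]) x = 0}"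
        by (intro poly_roots_finite) auto
      then have "finite (range (of_nat :: nat \<Rightarrow> int))"
        by (rule finite_subset[rotated]) (use roots in auto)
      then show False
        using range_inj_infinite[of "of_nat :: nat \<Rightarrow> int"] by (simp add: inj_on_def)
    qed
    moreover have "degree (pcompose p [:0, m:]) = degree p"
      using m by (simp add: degree_pcompose)
    moreover have "degree [:poly p 0, n:] \<le> 1"
      by simp
    ultimately show False
      using assms by simp
  qed
  moreover have "{k. poly p (k + m) - poly p k = n} = {k. poly ?q k = 0}"
    by (auto simp: poly_pcompose add.commute)
  moreover have "degree ?q \<le> degree p"
  proof (intro degree_diff_le)
    show "degree (pcompose p [:m, 1:]) \<le> degree p"
      by (simp add: degree_pcompose)
  qed auto
  ultimately show "finite {k. poly p (k + m) - poly p k = n} \<and>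
      card {k. poly p (k + m) - poly p k = n} \<le> degree p"
    using poly_roots_finite[of ?q] card_poly_roots_bound[of ?q] by auto
qed

section \<open>Density of trigonometric polynomials\<close>

definition trig_poly :: "(real \<Rightarrow> complex) \<Rightarrow> bool"
  where "trig_poly g \<longleftrightarrow> (\<exists>F a. finite F \<and> g = (\<lambda>x. \<Sum>k\<in>F. a k * cis (of_int k * x)))"

lemma trig_poly_monom: "trig_poly (\<lambda>x. c * cis (of_int k * x))"
  unfolding trig_poly_def by (rule exI[of _ "{k}"], rule exI[of _ "\<lambda>_. c"]) auto

lemma trig_poly_const: "trig_poly (\<lambda>x. c)"
  using trig_poly_monom[of c 0] by simp

lemma trig_poly_add:
  assumes "trig_poly f" "trig_poly g"
  shows "trig_poly (\<lambda>x. f x + g x)"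
proof -
  obtain F a where F: "finite F" "f = (\<lambda>x. \<Sum>k\<in>F. a k * cis (of_int k * x))"
    using assms(1) unfolding trig_poly_def by blast
  obtain H b where H: "finite H" "g = (\<lambda>x. \<Sum>k\<in>H. b k * cis (of_int k * x))"
    using assms(2) unfolding trig_poly_def by blast
  let ?c = "\<lambda>k. (if k \<in> F then a k else 0) + (if k \<in> H then b k else 0)"
  have "f x + g x = (\<Sum>k\<in>F \<union> H. ?c k * cis (of_int k * x))" for x
  proof -
    have "f x = (\<Sum>k\<in>F \<union> H. (if k \<in> F then a k else 0) * cis (of_int k * x))"
      unfolding F(2) using F(1) H(1) by (intro sum.mono_neutral_cong_left) auto
    moreover have "g x = (\<Sum>k\<in>F \<union> H. (if k \<in> H then b k else 0) * cis (of_int k * x))"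
      unfolding H(2) using F(1) H(1) by (intro sum.mono_neutral_cong_left) auto
    ultimately show ?thesis
      by (simp add: sum.distrib distrib_right)
  qed
  then show ?thesis
    unfolding trig_poly_def using F(1) H(1) by (intro exI[of _ "F \<union> H"] exI[of _ ?c]) auto
qed

lemma trig_poly_sum:
  "(\<And>i. i \<in> I \<Longrightarrow> trig_poly (f i)) \<Longrightarrow> trig_poly (\<lambda>x. \<Sum>i\<in>I. f i x)"
  by (induction I rule: infinite_finite_induct) (auto intro: trig_poly_const trig_poly_add)

lemma trig_poly_mult:
  assumes "trig_poly f" "trig_poly g"
  shows "trig_poly (\<lambda>x. f x * g x)"
proof -
  obtain F a where F: "finite F" "f = (\<lambda>x. \<Sum>k\<in>F. a k * cis (of_int k * x))"
    using assms(1) unfolding trig_poly_def by blast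
  obtain H b where H: "finite H" "g = (\<lambda>x. \<Sum>k\<in>H. b k * cis (of_int k * x))"
    using assms(2) unfolding trig_poly_def by blast
  have "(\<lambda>x. f x * g x) = (\<lambda>x. \<Sum>k\<in>F. \<Sum>l\<in>H. (a k * b l) * cis (of_int (k + l) * x))"
    unfolding F(2) H(2) sum_product by (simp add: cis_mult distrib_left distrib_right mult_ac)
  then show ?thesis
    by (simp only: trig_poly_sum trig_poly_monom)
qed

lemma trig_poly_real_polynomial:
  fixes g :: "complex \<Rightarrow> real"
  assumes "real_polynomial_function g"
  shows "trig_poly (\<lambda>x. of_real (g (cis x)))"
  using assms
proof (induction rule: real_polynomial_function.induct)
  case (linear f)
  interpret f: bounded_linear f by fact
  \<comment> \<open>Euler's formulas for \<open>cos\<close> and \<open>sin\<close>. As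
    \<open>f\<close> is only real linear, both frequencies 1 and -1 occur.\<close>
  let ?c = "(of_real (f 1) - \<i> * of_real (f \<i>)) / 2" and ?d = "(of_real (f 1) + \<i> * of_real (f \<i>)) / 2"
  have "complex_of_real (f (cis x)) = ?c * cis (of_int 1 * x) + ?d * cis (of_int (- 1) * x)" for x
  proof -
    have "cis x = cos x *\<^sub>R 1 + sin x *\<^sub>R \<i>"
      by (simp add: complex_eq_iff)
    then have "f (cis x) = cos x * f 1 + sin x * f \<i>"
      by (metis f.add f.scaleR real_scaleR_def)
    then show ?thesis
      by (simp add: complex_eq_iff field_simps)
  qed
  then show ?case
    using trig_poly_add[OF trig_poly_monom[of ?c 1] trig_poly_monom[of ?d "-1"]] by simp
next
  case (const c)
  show ?case by (rule trig_poly_const)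
next
  case (add f g)
  then show ?case using trig_poly_add by simp
next
  case (mult f g)
  then show ?case using trig_poly_mult by simp
qed

lemma trig_poly_polynomial:
  fixes g :: "complex \<Rightarrow> complex"
  assumes "polynomial_function g"
  shows "trig_poly (\<lambda>x. g (cis x))"
proof -
  have "real_polynomial_function (Re \<circ> g)" "real_polynomial_function (Im \<circ> g)"
    using assms bounded_linear_Re bounded_linear_Im unfolding polynomial_function_def by blast+
  then have "trig_poly (\<lambda>x. of_real ((Re \<circ> g) (cis x)) + \<i> * of_real ((Im \<circ> g) (cis x)))"
    by (intro trig_poly_add trig_poly_mult trig_poly_const trig_poly_real_polynomial)
  then show ?thesis
    by (simp add: complex_eq[symmetric])
qed

text \<open>Stone-Weierstrass on the unit circle of the complex plane: a polynomial in the real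
  coordinates of \<open>cis x\<close> is a trigonometric polynomial in \<open>x\<close>. The
  condition \<open>g 0 = g (2 * pi)\<close> repairs the jump of \<open>Arg2pi\<close>.\<close>

lemma uniform_approximation_trig_poly:
  fixes g :: "real \<Rightarrow> complex"
  assumes g: "continuous_on {0..2 * pi} g" "g 0 = g (2 * pi)" and e: "0 < e"
  obtains q where "trig_poly q" "\<And>x. x \<in> {0..<2 * pi} \<Longrightarrow> cmod (g x - q x) < e"
proof -
  let ?p = "\<lambda>t. g (2 * pi * t)"
  have "path ?p"
    unfolding path_def
    by (rule continuous_on_compose2[OF g(1)]) (auto intro!: continuous_intros simp: mult_left_le)
  \<comment> \<open>The loop is homotopic to itself; carrying this to maps of the circle yields the
    continuity of the induced map.\<close>
  then have "homotopic_loops UNIV ?p ?p"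
    by (subst homotopic_loops_refl) (use g(2) in \<open>auto simp: pathstart_def pathfinish_def\<close>)
  then have "homotopic_with_canon (\<lambda>h. True) (sphere 0 1) UNIV
      (?p \<circ> (\<lambda>z. Arg2pi z / (2 * pi))) (?p \<circ> (\<lambda>z. Arg2pi z / (2 * pi)))"
    by (rule homotopic_loops_imp_homotopic_circlemaps)
  then have "continuous_on (sphere 0 1) (?p \<circ> (\<lambda>z. Arg2pi z / (2 * pi)))"
    using homotopic_with_imp_continuous by blast
  moreover have "?p \<circ> (\<lambda>z. Arg2pi z / (2 * pi)) = (\<lambda>z. g (Arg2pi z))"
    by auto
  ultimately have cont: "continuous_on (sphere 0 1) (\<lambda>z. g (Arg2pi z))"
    by simp
  from Stone_Weierstrass_polynomial_function[OF compact_sphere cont e]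
  obtain h where h: "polynomial_function h" "\<forall>z\<in>sphere 0 1. cmod (g (Arg2pi z) - h z) < e"
    by (elim exE conjE)
  show ?thesis
  proof (rule that[of "\<lambda>x. h (cis x)"])
    show "trig_poly (\<lambda>x. h (cis x))"
      using h(1) by (rule trig_poly_polynomial)
    fix x :: real assume "x \<in> {0..<2 * pi}"
    then have "Arg2pi (cis x) = x"
      using Arg2pi_unique[of 1 x "cis x"] by (simp add: cis_conv_exp)
    moreover have "cmod (g (Arg2pi (cis x)) - h (cis x)) < e"
      by (rule bspec[OF h(2)]) simp
    ultimately show "cmod (g x - h (cis x)) < e"
      by simp
  qed
qed

section \<open>Approximation in the square-integrable functions on the circle\<close>

lemma circle_lebesgue: "circle \<in> sets lebesgue" and emeasure_circle: "emeasure lebesgue circle = ennreal (2 * pi)"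
  and measure_circle: "measure lebesgue circle = 2 * pi"
  unfolding circle_def by auto

lemma finite_measure_circle: "finite_measure (lebesgue_on circle)"
  by (rule finite_measureI) (simp add: space_restrict_space emeasure_restrict_space circle_lebesgue emeasure_circle)

lemma continuous_on_circle_L2:
  assumes "continuous_on UNIV f"
  shows "f \<in> circle_L2"
proof -
  have m: "f \<in> borel_measurable (lebesgue_on circle)"
    using assms by (intro measurable_restrict_space1 measurable_completion) (auto intro: borel_measurable_continuous_onI)
  have "compact (f ` {0..2 * pi})"
    by (intro compact_continuous_image continuous_on_subset[OF assms]) auto
  then obtain B where B: "\<And>x. x \<in> {0..2 * pi} \<Longrightarrow> cmod (f x) \<le> B"
    using compact_imp_bounded bounded_iff by (metis image_eqI)
  have "integrable (lebesgue_on circle) (\<lambda>x. (cmod (f x))\<^sup>2)"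
    by (rule finite_measure.integrable_const_bound[OF finite_measure_circle, where B = "B\<^sup>2"])
      (use m B in \<open>auto simp: space_restrict_space circle_def intro!: AE_I2 power_mono\<close>)
  with m show ?thesis by (simp add: circle_L2_def)
qed

lemma circle_L2_diff:
  assumes "f \<in> circle_L2" "g \<in> circle_L2"
  shows "(\<lambda>x. f x - g x) \<in> circle_L2"
proof -
  have le: "(cmod (x - y))\<^sup>2 \<le> 2 * (cmod x)\<^sup>2 + 2 * (cmod y)\<^sup>2" for x y
    by (rule cmod_diff_square_le)
  have "integrable (lebesgue_on circle) (\<lambda>x. 2 * (cmod (f x))\<^sup>2 + 2 * (cmod (g x))\<^sup>2)"
    using assms by (auto simp: circle_L2_def)
  then have "integrable (lebesgue_on circle) (\<lambda>x. (cmod (f x - g x))\<^sup>2)"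
    by (rule Bochner_Integration.integrable_bound) (use assms le in \<open>auto simp: circle_L2_def\<close>)
  then show ?thesis
    using assms by (auto simp: circle_L2_def)
qed

lemma continuous_on_trig_poly: "trig_poly g \<Longrightarrow> continuous_on A g"
  unfolding trig_poly_def by (auto intro!: continuous_intros)

lemma trig_poly_circle_L2: "trig_poly g \<Longrightarrow> g \<in> circle_L2"
  by (intro continuous_on_circle_L2 continuous_on_trig_poly)

definition trig_approximable :: "(real \<Rightarrow> complex) \<Rightarrow> bool"
  where "trig_approximable f \<longleftrightarrow>
    (\<forall>e>0. \<exists>q. trig_poly q \<and> (LINT x|lebesgue_on circle. (cmod (f x - q x))\<^sup>2) < e)"

lemma trig_approximable_limit:
  assumes f: "f \<in> circle_L2" and g: "\<And>n. g n \<in> circle_L2" "\<And>n. trig_approximable (g n)"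
    and lim: "(\<lambda>n. LINT x|lebesgue_on circle. (cmod (f x - g n x))\<^sup>2) \<longlonglongrightarrow> 0"
  shows "trig_approximable f"
  unfolding trig_approximable_def
proof (intro allI impI)
  fix e :: real assume e: "0 < e"
  let ?d = "\<lambda>f g. LINT x|lebesgue_on circle. (cmod (f x - g x))\<^sup>2"
  \<comment> \<open>Both errors are doubled by the squared triangle inequality, hence the
    quarters.\<close>
  have "\<forall>\<^sub>F n in sequentially. ?d f (g n) < e / 4"
    using lim e by (intro order_tendstoD) auto
  then obtain n where n: "?d f (g n) < e / 4"
    using eventually_happens'[OF sequentially_bot] by blast
  have "0 < e / 4"
    using e by simp
  then obtain q where q: "trig_poly q" "?d (g n) q < e / 4"
    using g(2)[of n] unfolding trig_approximable_def by blast
  have int: "integrable (lebesgue_on circle) (\<lambda>x. (cmod (f x - g n x))\<^sup>2)"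
    "integrable (lebesgue_on circle) (\<lambda>x. (cmod (g n x - q x))\<^sup>2)"
    "integrable (lebesgue_on circle) (\<lambda>x. (cmod (f x - q x))\<^sup>2)"
    using circle_L2_diff[OF f g(1)] circle_L2_diff[OF g(1) trig_poly_circle_L2[OF q(1)]]
      circle_L2_diff[OF f trig_poly_circle_L2[OF q(1)]] by (auto simp: circle_L2_def)
  have "?d f q \<le> (LINT x|lebesgue_on circle. 2 * (cmod (f x - g n x))\<^sup>2 + 2 * (cmod (g n x - q x))\<^sup>2)"
  proof (rule integral_mono)
    show "(cmod (f x - q x))\<^sup>2 \<le> 2 * (cmod (f x - g n x))\<^sup>2 + 2 * (cmod (g n x - q x))\<^sup>2" for x
      using cmod_diff_square_le[of "f x - g n x" "q x - g n x"] by (simp add: norm_minus_commute)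
  qed (use int in auto)
  also have "\<dots> = 2 * ?d f (g n) + 2 * ?d (g n) q"
    using int by simp
  also have "\<dots> < e"
    using n q(2) by simp
  finally show "\<exists>q. trig_poly q \<and> ?d f q < e"
    using q(1) by blast
qed

lemma trig_approximable_continuous:
  assumes g: "continuous_on UNIV g" "g 0 = g (2 * pi)"
  shows "trig_approximable g"
  unfolding trig_approximable_def
proof (intro allI impI)
  fix e :: real assume e: "0 < e"
  \<comment> \<open>A uniform error \<open>r\<close> gives the squared error 2 pi r^2 = e/2.\<close>
  define r where "r = sqrt (e / (4 * pi))"
  have r: "0 < r" "r\<^sup>2 = e / (4 * pi)"
    using e by (auto simp: r_def)
  obtain q where q: "trig_poly q" "\<And>x. x \<in> {0..<2 * pi} \<Longrightarrow> cmod (g x - q x) < r"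
    using uniform_approximation_trig_poly[OF continuous_on_subset[OF g(1)] g(2) r(1)] by blast
  have "(LINT x|lebesgue_on circle. (cmod (g x - q x))\<^sup>2) \<le> (LINT x|lebesgue_on circle. r\<^sup>2)"
  proof (rule integral_mono)
    show "integrable (lebesgue_on circle) (\<lambda>x. (cmod (g x - q x))\<^sup>2)"
      using circle_L2_diff[OF continuous_on_circle_L2[OF g(1)] trig_poly_circle_L2[OF q(1)]]
      by (simp add: circle_L2_def)
    fix x assume "x \<in> space (lebesgue_on circle)"
    then show "(cmod (g x - q x))\<^sup>2 \<le> r\<^sup>2"
      using q(2)[of x] by (intro power_mono) (auto simp: space_restrict_space circle_def)
  qed (rule finite_measure.integrable_const[OF finite_measure_circle])
  also have "\<dots> = e / 2"
    by (simp add: measure_restrict_space circle_lebesgue space_restrict_space measure_circle r(2))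
  also have "\<dots> < e"
    using e by simp
  finally show "\<exists>q. trig_poly q \<and> (LINT x|lebesgue_on circle. (cmod (g x - q x))\<^sup>2) < e"
    using q(1) by blast
qed

lemma AE_lebesgue_on_negligible:
  assumes "S \<in> sets lebesgue" "negligible N" "\<And>x. x \<in> S \<Longrightarrow> x \<notin> N \<Longrightarrow> P x"
  shows "AE x in lebesgue_on S. P x"
proof -
  have "AE x in lebesgue. x \<notin> N"
    using assms(2) by (intro AE_not_in) (simp add: negligible_iff_null_sets)
  then show ?thesis
    using assms by (subst AE_restrict_space_iff) (auto elim: eventually_mono)
qed

text \<open>A measurable function is an almost everywhere limit of continuous functions. These are
  corrected to be bounded, for dominated convergence, and to match at 0 and 2 pi, for the uniform
  approximation.\<close>

lemma trig_approximable_bounded: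
  assumes f: "f \<in> borel_measurable (lebesgue_on circle)" and B: "\<And>x. cmod (f x) \<le> B"
  shows "trig_approximable f"
proof -
  have "f measurable_on circle"
    using f circle_lebesgue by (simp add: measurable_on_iff_borel_measurable)
  then obtain N g where Ng: "negligible N \<and> (\<forall>n. continuous_on UNIV (g n)) \<and>
      (\<forall>x. x \<notin> N \<longrightarrow> (\<lambda>n. g n x) \<longlonglongrightarrow> (if x \<in> circle then f x else 0))"
    unfolding measurable_on_def by blast
  then have N: "negligible N" and g: "\<And>n. continuous_on UNIV (g n)"
    "\<And>x. x \<notin> N \<Longrightarrow> (\<lambda>n. g n x) \<longlonglongrightarrow> (if x \<in> circle then f x else 0)"
    by blast+
  have B0: "0 \<le> B"
    using B[of 0] norm_ge_zero order_trans by blast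
  \<comment> \<open>The continuous projection onto the ball of radius \<open>B\<close> fixes the
    values of \<open>f\<close>.\<close>
  let ?P = "closest_point (cball (0::complex) B)"
  have P: "closed (cball (0::complex) B)" "convex (cball (0::complex) B)" "cball (0::complex) B \<noteq> {}"
    using B0 by auto
  have Pc: "continuous_on UNIV ?P"
    by (rule continuous_on_closest_point[OF P(2,1,3)])
  \<comment> \<open>A continuous cutoff that vanishes at 0 and 2 pi and is eventually 1 at each
    point strictly between; this is why the point 0 joins the exceptional set below.\<close>
  define \<theta> where "\<theta> n x = min 1 (real n * max 0 (x * (2 * pi - x)))" for n x
  define h where "h n x = of_real (\<theta> n x) * ?P (g n x)" for n x
  have \<theta>: "0 \<le> \<theta> n x" "\<theta> n x \<le> 1" for n x
    by (auto simp: \<theta>_def)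
  have hc: "continuous_on UNIV (h n)" for n
    unfolding h_def \<theta>_def by (intro continuous_intros continuous_on_compose2[OF Pc g(1)]) auto
  have hB: "cmod (h n x) \<le> B" for n x
  proof -
    have "?P (g n x) \<in> cball 0 B"
      by (rule closest_point_in_set[OF P(1,3)])
    then show ?thesis
      using mult_mono[OF \<theta>(2) _ _ norm_ge_zero, of "?P (g n x)" B n x] \<theta>(1)[of n x]
      by (simp add: h_def norm_mult)
  qed
  have fL2: "f \<in> circle_L2"
  proof -
    have "integrable (lebesgue_on circle) (\<lambda>x. (cmod (f x))\<^sup>2)"
      by (rule finite_measure.integrable_const_bound[OF finite_measure_circle, where B = "B\<^sup>2"]) (use f B in \<open>auto intro!: power_mono\<close>)
    with f show ?thesis by (simp add: circle_L2_def)
  qed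
  have hL2: "h n \<in> circle_L2" for n
    by (rule continuous_on_circle_L2[OF hc])
  have lim: "(\<lambda>n. h n x) \<longlonglongrightarrow> f x" if "x \<in> circle" "x \<notin> insert 0 N" for x
  proof -
    have x: "0 < x" "x < 2 * pi"
      using that by (auto simp: circle_def)
    have P_lim: "(\<lambda>n. ?P (g n x)) \<longlonglongrightarrow> ?P (f x)"
      using Pc g(2)[of x] that by (intro continuous_on_tendsto_compose[OF Pc]) auto
    have P_id: "?P (f x) = f x"
      using B by (intro closest_point_self) auto
    have "(\<lambda>n. complex_of_real (\<theta> n x)) \<longlonglongrightarrow> of_real 1"
    proof (rule tendsto_of_real, rule tendsto_eventually)
      obtain m where m: "1 \<le> real m * (x * (2 * pi - x))"
        using reals_Archimedean3[of "x * (2 * pi - x)"] x by (meson diff_gt_0_iff_gt less_imp_le mult_pos_pos)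
      have "\<theta> n x = 1" if "m \<le> n" for n
      proof -
        have "real m * (x * (2 * pi - x)) \<le> real n * (x * (2 * pi - x))"
          using that x by (intro mult_right_mono) auto
        with m have "1 \<le> real n * (x * (2 * pi - x))"
          by (rule order_trans)
        then show ?thesis
          using x by (simp add: \<theta>_def min_absorb1)
      qed
      then show "\<forall>\<^sub>F n in sequentially. \<theta> n x = 1"
        unfolding eventually_sequentially by blast
    qed
    from tendsto_mult[OF this P_lim] show ?thesis
      by (simp add: h_def P_id)
  qed
  show ?thesis
  proof (rule trig_approximable_limit[OF fL2 hL2])
    show "trig_approximable (h n)" for n
      by (rule trig_approximable_continuous[OF hc]) (simp add: h_def \<theta>_def)
    have "(\<lambda>n. LINT x|lebesgue_on circle. (cmod (f x - h n x))\<^sup>2) \<longlonglongrightarrow> (LINT x|lebesgue_on circle. 0)"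
    proof (rule integral_dominated_convergence[where w = "\<lambda>_. 4 * B\<^sup>2"])
      show "integrable (lebesgue_on circle) (\<lambda>_. 4 * B\<^sup>2)"
        by (rule finite_measure.integrable_const[OF finite_measure_circle])
      show "(\<lambda>x. (cmod (f x - h n x))\<^sup>2) \<in> borel_measurable (lebesgue_on circle)" for n
        using circle_L2_diff[OF fL2 hL2] by (auto simp: circle_L2_def)
      show "AE x in lebesgue_on circle. norm ((cmod (f x - h n x))\<^sup>2) \<le> 4 * B\<^sup>2" for n
      proof (rule AE_I2)
        fix x
        have "(cmod (f x))\<^sup>2 \<le> B\<^sup>2" "(cmod (h n x))\<^sup>2 \<le> B\<^sup>2"
          using B hB by (auto intro!: power_mono)
        then show "norm ((cmod (f x - h n x))\<^sup>2) \<le> 4 * B\<^sup>2"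
          using cmod_diff_square_le[of "f x" "h n x"] by simp
      qed
      show "AE x in lebesgue_on circle. (\<lambda>n. (cmod (f x - h n x))\<^sup>2) \<longlonglongrightarrow> 0"
      proof (rule AE_lebesgue_on_negligible[OF circle_lebesgue])
        show "negligible (insert 0 N)"
          using N by simp
        fix x assume "x \<in> circle" "x \<notin> insert 0 N"
        then have "(\<lambda>n. (cmod (f x - h n x))\<^sup>2) \<longlonglongrightarrow> (cmod (f x - f x))\<^sup>2"
          by (intro tendsto_intros lim) auto
        then show "(\<lambda>n. (cmod (f x - h n x))\<^sup>2) \<longlonglongrightarrow> 0"
          by simp
      qed
    qed simp
    then show "(\<lambda>n. LINT x|lebesgue_on circle. (cmod (f x - h n x))\<^sup>2) \<longlonglongrightarrow> 0"
      by simp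
  qed
qed

lemma trig_approximable_circle_L2:
  assumes f: "f \<in> circle_L2"
  shows "trig_approximable f"
proof -
  \<comment> \<open>Truncation by height: at each point it is eventually exact, and the squared
    error is dominated by \<open>(cmod (f x))\<^sup>2\<close>.\<close>
  define g where "g n x = (if cmod (f x) \<le> real n then f x else 0)" for n x
  have fm: "f \<in> borel_measurable (lebesgue_on circle)"
    and fi: "integrable (lebesgue_on circle) (\<lambda>x. (cmod (f x))\<^sup>2)"
    using f by (auto simp: circle_L2_def)
  have gm: "g n \<in> borel_measurable (lebesgue_on circle)" for n
    unfolding g_def using fm by measurable
  have gL2: "g n \<in> circle_L2" for n
  proof -
    have "(\<lambda>x. (cmod (g n x))\<^sup>2) \<in> borel_measurable (lebesgue_on circle)"
      using gm by measurable
    then have "integrable (lebesgue_on circle) (\<lambda>x. (cmod (g n x))\<^sup>2)"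
      by (rule Bochner_Integration.integrable_bound[OF fi]) (simp add: g_def)
    with gm show ?thesis
      by (simp add: circle_L2_def)
  qed
  show ?thesis
  proof (rule trig_approximable_limit[OF f gL2])
    show "trig_approximable (g n)" for n
      by (rule trig_approximable_bounded[OF gm, where B = "real n"]) (simp add: g_def)
    have "(\<lambda>n. LINT x|lebesgue_on circle. (cmod (f x - g n x))\<^sup>2) \<longlonglongrightarrow> (LINT x|lebesgue_on circle. 0)"
    proof (rule integral_dominated_convergence[OF _ _ fi])
      show "(\<lambda>x. (cmod (f x - g n x))\<^sup>2) \<in> borel_measurable (lebesgue_on circle)" for n
        using circle_L2_diff[OF f gL2] by (auto simp: circle_L2_def)
      show "AE x in lebesgue_on circle. norm ((cmod (f x - g n x))\<^sup>2) \<le> (cmod (f x))\<^sup>2" for n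
        by (auto simp: g_def)
      show "AE x in lebesgue_on circle. (\<lambda>n. (cmod (f x - g n x))\<^sup>2) \<longlonglongrightarrow> 0"
      proof (rule AE_I2)
        fix x
        obtain m where "cmod (f x) \<le> real m"
          using real_arch_simple by blast
        then have "\<forall>n\<ge>m. (cmod (f x - g n x))\<^sup>2 = 0"
          by (auto simp: g_def)
        then show "(\<lambda>n. (cmod (f x - g n x))\<^sup>2) \<longlonglongrightarrow> 0"
          by (intro tendsto_eventually) (auto simp: eventually_sequentially)
      qed
    qed simp
    then show "(\<lambda>n. LINT x|lebesgue_on circle. (cmod (f x - g n x))\<^sup>2) \<longlonglongrightarrow> 0"
      by simp
  qed
qed

section \<open>Bessel's inequality and Parseval's identity on the circle\<close>

lemma integral_circle_cis:
  fixes k :: int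
  shows "(LINT x|lebesgue_on circle. cis (of_int k * x)) = (if k = 0 then of_real (2 * pi) else 0)"
proof -
  have "(\<lambda>x. cis (of_int k * x)) \<in> circle_L2"
    by (intro continuous_on_circle_L2 continuous_intros)
  then have "integrable (lebesgue_on circle) (\<lambda>x. cis (of_int k * x))"
    unfolding circle_L2_def mem_Collect_eq
    by (elim conjE) (rule integrable_of_square_integrable[OF finite_measure_circle])
  then have "(LINT x|lebesgue_on circle. cis (of_int k * x)) = integral circle (\<lambda>x. cis (of_int k * x))"
    using circle_lebesgue by (rule lebesgue_integral_eq_integral)
  also have "\<dots> = integral {0..2 * pi} (\<lambda>x. cis (of_int k * x))"
    unfolding circle_def
  proof (rule integral_spike_set)
    have "negligible {2 * pi}"
      by simp
    then show "negligible {x \<in> {0..<2 * pi} - {0..2 * pi}. cis (of_int k * x) \<noteq> 0}"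
      "negligible {x \<in> {0..2 * pi} - {0..<2 * pi}. cis (of_int k * x) \<noteq> 0}"
      by (rule negligible_subset; force)+
  qed
  also have "\<dots> = (if k = 0 then of_real (2 * pi) else 0)"
    using has_integral_cis_period[of k 0] by (simp add: integral_unique)
  finally show ?thesis .
qed

lemma
  assumes f: "f \<in> circle_L2" and F: "finite F"
  shows circle_L2_remainder: "(\<lambda>x. f x - (\<Sum>k\<in>F. a k * cis (of_int k * x))) \<in> circle_L2"
    and integral_circle_remainder:
    "(LINT x|lebesgue_on circle. (cmod (f x - (\<Sum>k\<in>F. a k * cis (of_int k * x))))\<^sup>2) =
       (L2_norm f)\<^sup>2 - 2 * pi * energy (fourier_coeff f) F
         + 2 * pi * (\<Sum>k\<in>F. (cmod (a k - fourier_coeff f k))\<^sup>2)"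
proof -
  show "(\<lambda>x. f x - (\<Sum>k\<in>F. a k * cis (of_int k * x))) \<in> circle_L2"
    using F by (intro circle_L2_diff f trig_poly_circle_L2) (auto simp: trig_poly_def)
  let ?e = "\<lambda>(k::int) x. cis (of_int k * x)"
  have fm: "f \<in> borel_measurable (lebesgue_on circle)"
    and fi: "integrable (lebesgue_on circle) (\<lambda>x. (cmod (f x))\<^sup>2)"
    using f by (auto simp: circle_L2_def)
  have e: "?e k \<in> borel_measurable (lebesgue_on circle)" for k
  proof -
    have "?e k \<in> circle_L2"
      by (intro continuous_on_circle_L2 continuous_intros)
    then show ?thesis
      by (simp add: circle_L2_def)
  qed
  have orth: "(LINT x|lebesgue_on circle. ?e k x * cnj (?e l x)) = (if k = l then of_real (2 * pi) else 0)" for k l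
  proof -
    have "(\<lambda>x. ?e k x * cnj (?e l x)) = ?e (k - l)"
      by (auto simp: cis_cnj cis_mult algebra_simps)
    then show ?thesis
      by (simp only: integral_circle_cis) simp
  qed
  have c: "(LINT x|lebesgue_on circle. f x * cnj (?e k x)) = of_real (2 * pi) * fourier_coeff f k" for k
  proof -
    have "cnj (?e k x) = exp (- \<i> * of_int k * of_real x)" for x
    proof -
      have "cnj (?e k x) = cis (- (of_int k * x))"
        by (simp add: cis_cnj)
      then show ?thesis
        unfolding cis_conv_exp by (simp add: mult.assoc)
    qed
    then show ?thesis
      by (simp only: fourier_coeff_def) simp
  qed
  have L2: "(L2_norm f)\<^sup>2 = (LINT x|lebesgue_on circle. (cmod (f x))\<^sup>2)"
    unfolding L2_norm_def by (intro real_sqrt_pow2 integral_nonneg_AE) auto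
  show "(LINT x|lebesgue_on circle. (cmod (f x - (\<Sum>k\<in>F. a k * cis (of_int k * x))))\<^sup>2) =
       (L2_norm f)\<^sup>2 - 2 * pi * energy (fourier_coeff f) F
         + 2 * pi * (\<Sum>k\<in>F. (cmod (a k - fourier_coeff f k))\<^sup>2)"
    unfolding L2 energy_def
    by (rule integral_orthogonal_remainder[OF finite_measure_circle F fm fi e _ orth c]) simp
qed

lemma bessel_circle:
  assumes "f \<in> circle_L2" "finite F"
  shows "2 * pi * energy (fourier_coeff f) F \<le> (L2_norm f)\<^sup>2"
proof -
  have "0 \<le> (LINT x|lebesgue_on circle. (cmod (f x - (\<Sum>k\<in>F. fourier_coeff f k * cis (of_int k * x))))\<^sup>2)"
    by (intro integral_nonneg_AE) auto
  then show ?thesis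
    unfolding integral_circle_remainder[OF assms] by simp
qed

text \<open>The Fourier partial sum over the frequencies of an approximating \<open>q\<close> is at
  least as close to \<open>f\<close> as \<open>q\<close> itself, by the nonnegative last term of the
  remainder formula.\<close>

lemma parseval_circle:
  assumes f: "f \<in> circle_L2" and e: "0 < e"
  obtains F where "finite F" "(L2_norm f)\<^sup>2 - 2 * pi * energy (fourier_coeff f) F < e"
proof -
  obtain q where q: "trig_poly q" "(LINT x|lebesgue_on circle. (cmod (f x - q x))\<^sup>2) < e"
    using trig_approximable_circle_L2[OF f] e unfolding trig_approximable_def by blast
  obtain F a where F: "finite F" "q = (\<lambda>x. \<Sum>k\<in>F. a k * cis (of_int k * x))"
    using q(1) unfolding trig_poly_def by blast
  have "0 \<le> 2 * pi * (\<Sum>k\<in>F. (cmod (a k - fourier_coeff f k))\<^sup>2)"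
    by (intro mult_nonneg_nonneg sum_nonneg) auto
  then have "(L2_norm f)\<^sup>2 - 2 * pi * energy (fourier_coeff f) F < e"
    using q(2) unfolding F(2) integral_circle_remainder[OF f F(1)] by linarith
  then show ?thesis
    using that F(1) by blast
qed

section \<open>From finite sums to solutions\<close>

text \<open>Integration of the slice bounds over time. Extended nonnegative integrals are used first
  because integrability on the strip is itself to be deduced from the bound.\<close>

lemma nn_integral_strip_le:
  fixes w :: "real \<Rightarrow> real \<Rightarrow> complex"
  assumes T: "0 \<le> T" and w: "(\<lambda>(t, x). w t x) \<in> borel_measurable (lebesgue_on ({0..T} \<times> circle))"
    and wt: "\<And>t. t \<in> {0..T} \<Longrightarrow> w t \<in> circle_L2"
      "\<And>t. t \<in> {0..T} \<Longrightarrow> (LINT x|lebesgue_on circle. (cmod (w t x))\<^sup>2) \<le> R"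
  shows "(\<integral>\<^sup>+z. ennreal (indicator ({0..T} \<times> circle) z * (cmod (w (fst z) (snd z)))\<^sup>2) \<partial>lebesgue)
     \<le> ennreal (T * R)"
proof -
  let ?B = "{0..T} \<times> circle"
  define f where "f z = ennreal (indicator ?B z * (cmod (w (fst z) (snd z)))\<^sup>2)" for z
  have B: "?B \<in> sets lebesgue"
    unfolding circle_def by (intro sets_completionI_sets) (auto simp: borel_Times)
  have "0 \<le> (LINT x|lebesgue_on circle. (cmod (w 0 x))\<^sup>2)"
    by (intro integral_nonneg_AE) auto
  also have "\<dots> \<le> R"
    using T by (intro wt) auto
  finally have R: "0 \<le> R" .
  have "(\<lambda>z. (cmod (w (fst z) (snd z)))\<^sup>2) \<in> borel_measurable (lebesgue_on ?B)"
    using w by (auto simp: case_prod_unfold)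
  then have "(\<lambda>z. indicator ?B z *\<^sub>R (cmod (w (fst z) (snd z)))\<^sup>2) \<in> borel_measurable lebesgue"
    using B by (subst (asm) borel_measurable_restrict_space_iff) auto
  then have f: "f \<in> borel_measurable lebesgue"
    unfolding f_def by simp
  \<comment> \<open>Tonelli's theorem is applied to a Borel version on the product measure; for
    almost every \<open>t\<close> its slice agrees almost everywhere with that of
    \<open>f\<close>.\<close>
  obtain f' where f': "f' \<in> borel_measurable lborel" "AE z in lborel. f z = f' z"
    using completion_ex_borel_measurable[OF f] by blast
  have "AE z in lborel \<Otimes>\<^sub>M lborel. f z = f' z"
    unfolding lborel_prod by (rule f'(2))
  then have ae: "AE t in lborel. AE x in lborel. f (t, x) = f' (t, x)"
    by (rule lborel_pair.AE_pair)
  have inner: "(\<integral>\<^sup>+x. f (t, x) \<partial>lborel) \<le> ennreal R * indicator {0..T} t" for t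
  proof (cases "t \<in> {0..T}")
    case False
    then have "f (t, x) = 0" for x
      by (auto simp: f_def indicator_def)
    then show ?thesis by simp
  next
    case True
    have int: "integrable (lebesgue_on circle) (\<lambda>x. (cmod (w t x))\<^sup>2)"
      using wt(1)[OF True] by (simp add: circle_L2_def)
    have "(\<integral>\<^sup>+x. f (t, x) \<partial>lborel) = (\<integral>\<^sup>+x. f (t, x) \<partial>lebesgue)"
      by (simp add: nn_integral_completion)
    also have "\<dots> = (\<integral>\<^sup>+x. ennreal ((cmod (w t x))\<^sup>2) * indicator circle x \<partial>lebesgue)"
      using True by (intro nn_integral_cong) (auto simp: f_def indicator_def)
    also have "\<dots> = (\<integral>\<^sup>+x. ennreal ((cmod (w t x))\<^sup>2) \<partial>lebesgue_on circle)"
      using circle_lebesgue by (subst nn_integral_restrict_space) auto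
    also have "\<dots> = ennreal (LINT x|lebesgue_on circle. (cmod (w t x))\<^sup>2)"
      by (rule nn_integral_eq_integral[OF int]) simp
    also have "\<dots> \<le> ennreal R"
      by (intro ennreal_leI wt True)
    finally show ?thesis
      using True by simp
  qed
  have "(\<integral>\<^sup>+z. f z \<partial>lebesgue) = (\<integral>\<^sup>+z. f z \<partial>lborel)"
    by (simp add: nn_integral_completion)
  also have "\<dots> = (\<integral>\<^sup>+z. f' z \<partial>lborel)"
    using f'(2) by (rule nn_integral_cong_AE)
  also have "\<dots> = (\<integral>\<^sup>+z. f' z \<partial>(lborel \<Otimes>\<^sub>M lborel))"
    by (simp add: lborel_prod)
  also have "\<dots> = (\<integral>\<^sup>+t. \<integral>\<^sup>+x. f' (t, x) \<partial>lborel \<partial>lborel)"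
    using f'(1) by (intro lborel.nn_integral_fst[symmetric]) (simp add: lborel_prod)
  also have "\<dots> \<le> (\<integral>\<^sup>+t. ennreal R * indicator {0..T} t \<partial>lborel)"
  proof (rule nn_integral_mono_AE)
    show "AE t in lborel. (\<integral>\<^sup>+x. f' (t, x) \<partial>lborel) \<le> ennreal R * indicator {0..T} t"
      using ae
    proof eventually_elim
      case (elim t)
      then have "(\<integral>\<^sup>+x. f' (t, x) \<partial>lborel) = (\<integral>\<^sup>+x. f (t, x) \<partial>lborel)"
        by (intro nn_integral_cong_AE) auto
      then show ?case
        using inner[of t] by simp
    qed
  qed
  also have "\<dots> = ennreal (T * R)"
    using T R by (simp add: nn_integral_cmult_indicator ennreal_mult mult.commute)
  finally show ?thesis
    unfolding f_def .
qed

lemma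
  fixes w :: "real \<Rightarrow> real \<Rightarrow> complex"
  assumes T: "0 \<le> T" and w: "(\<lambda>(t, x). w t x) \<in> borel_measurable (lebesgue_on ({0..T} \<times> circle))"
    and wt: "\<And>t. t \<in> {0..T} \<Longrightarrow> w t \<in> circle_L2"
      "\<And>t. t \<in> {0..T} \<Longrightarrow> (LINT x|lebesgue_on circle. (cmod (w t x))\<^sup>2) \<le> R"
  shows set_integrable_strip: "set_integrable lebesgue ({0..T} \<times> circle) (\<lambda>(t, x). (cmod (w t x))\<^sup>2)"
    and set_integral_strip_le: "(LINT (t, x):{0..T} \<times> circle|lebesgue. (cmod (w t x))\<^sup>2) \<le> T * R"
proof -
  let ?B = "{0..T} \<times> circle"
  let ?f = "\<lambda>z. indicator ?B z * (cmod (w (fst z) (snd z)))\<^sup>2"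
  have B: "?B \<in> sets lebesgue"
    unfolding circle_def by (intro sets_completionI_sets) (auto simp: borel_Times)
  have "(\<lambda>z. (cmod (w (fst z) (snd z)))\<^sup>2) \<in> borel_measurable (lebesgue_on ?B)"
    using w by (auto simp: case_prod_unfold)
  then have "(\<lambda>z. indicator ?B z *\<^sub>R (cmod (w (fst z) (snd z)))\<^sup>2) \<in> borel_measurable lebesgue"
    using B by (subst (asm) borel_measurable_restrict_space_iff) auto
  then have meas: "?f \<in> borel_measurable lebesgue"
    by simp
  have le: "(\<integral>\<^sup>+z. ennreal (?f z) \<partial>lebesgue) \<le> ennreal (T * R)"
    using assms by (rule nn_integral_strip_le)
  have int: "integrable lebesgue ?f"
    using meas by (rule integrableI_nonneg) (use le in \<open>auto intro: le_less_trans\<close>)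
  have "0 \<le> (LINT x|lebesgue_on circle. (cmod (w 0 x))\<^sup>2)"
    by (intro integral_nonneg_AE) auto
  also have "\<dots> \<le> R"
    using T by (intro wt) auto
  finally have R: "0 \<le> R" .
  have "ennreal (integral\<^sup>L lebesgue ?f) = (\<integral>\<^sup>+z. ennreal (?f z) \<partial>lebesgue)"
    using int by (intro nn_integral_eq_integral[symmetric]) auto
  with le have "ennreal (integral\<^sup>L lebesgue ?f) \<le> ennreal (T * R)"
    by simp
  then have "integral\<^sup>L lebesgue ?f \<le> T * R"
    using T R by (subst (asm) ennreal_le_iff) auto
  with int show "set_integrable lebesgue ?B (\<lambda>(t, x). (cmod (w t x))\<^sup>2)"
    "(LINT (t, x):?B|lebesgue. (cmod (w t x))\<^sup>2) \<le> T * R"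
    by (simp_all add: set_integrable_def set_lebesgue_integral_def case_prod_unfold)
qed

text \<open>Parseval for \<open>f\<close> and Bessel for \<open>g\<close>, up to an arbitrary error.
  The hypothesis is symmetric, so exchanging the functions gives equality of norms.\<close>

lemma L2_norm_le_if_fourier_coeff:
  assumes "f \<in> circle_L2" "g \<in> circle_L2" "\<And>k. cmod (fourier_coeff f k) = cmod (fourier_coeff g k)"
  shows "(L2_norm f)\<^sup>2 \<le> (L2_norm g)\<^sup>2"
proof (rule field_le_epsilon)
  fix e :: real assume "0 < e"
  then obtain F where F: "finite F" "(L2_norm f)\<^sup>2 - 2 * pi * energy (fourier_coeff f) F < e"
    using parseval_circle[OF assms(1)] by blast
  have "energy (fourier_coeff f) F = energy (fourier_coeff g) F"
    by (simp add: energy_def assms(3))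
  then show "(L2_norm f)\<^sup>2 \<le> (L2_norm g)\<^sup>2 + e"
    using F bessel_circle[OF assms(2) F(1)] by simp
qed

text \<open>The propagator multiplies every coefficient by a number of modulus one, so norm and
  truncation error do not change in time. One finite \<open>F\<close> then serves all
  \<open>t\<close> at once.\<close>

lemma
  assumes u: "is_solution p T u0 u" and t: "t \<in> {0..T}" and F: "finite F"
  shows solution_remainder_circle_L2: "(\<lambda>x. u t x - wave (poly p) (fourier_coeff u0) F (t, x)) \<in> circle_L2"
    and solution_remainder: "(LINT x|lebesgue_on circle. (cmod (u t x - wave (poly p) (fourier_coeff u0) F (t, x)))\<^sup>2)
       = (L2_norm u0)\<^sup>2 - 2 * pi * energy (fourier_coeff u0) F"
proof -
  let ?a = "\<lambda>k. cis (of_int (poly p k) * t) * fourier_coeff u0 k"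
  have L2: "u0 \<in> circle_L2" "u t \<in> circle_L2"
    and coeff: "fourier_coeff (u t) k = ?a k" for k
    using u t by (auto simp: is_solution_def is_multiplier_image_def propagator_symbol_def cis_conv_exp mult_ac)
  have wave: "wave (poly p) (fourier_coeff u0) F (t, x) = (\<Sum>k\<in>F. ?a k * cis (of_int k * x))" for x
    unfolding wave_def chi_def by (intro sum.cong) (auto simp: cis_mult[symmetric])
  have norm: "cmod (fourier_coeff (u t) k) = cmod (fourier_coeff u0 k)" for k
    by (simp add: coeff norm_mult)
  have energy: "energy (fourier_coeff (u t)) F = energy (fourier_coeff u0) F"
    by (simp add: energy_def norm)
  have "(L2_norm (u t))\<^sup>2 = (L2_norm u0)\<^sup>2"
    using L2 norm by (intro antisym L2_norm_le_if_fourier_coeff) auto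
  then show "(LINT x|lebesgue_on circle. (cmod (u t x - wave (poly p) (fourier_coeff u0) F (t, x)))\<^sup>2)
       = (L2_norm u0)\<^sup>2 - 2 * pi * energy (fourier_coeff u0) F"
    unfolding wave integral_circle_remainder[OF L2(2) F] energy by (simp add: coeff)
  show "(\<lambda>x. u t x - wave (poly p) (fourier_coeff u0) F (t, x)) \<in> circle_L2"
    unfolding wave by (rule circle_L2_remainder[OF L2(2) F])
qed

lemma observable_emptyE:
  assumes "observable \<phi> A {}"
  obtains c where "0 < c" "\<And>a F. finite F \<Longrightarrow>
      c * energy a F \<le> (LINT z:A|lborel. (cmod (wave \<phi> a F z))\<^sup>2)"
  using assms unfolding observable_def by auto

text \<open>Countably many period boxes cover \<open>G\<close>, so one of them meets it in positive
  measure; inner regularity then supplies a closed, and in the box compact, subset.\<close>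

lemma compact_subset_positive_measure:
  assumes G: "G \<subseteq> {0..T} \<times> circle" "G \<in> sets lebesgue" "emeasure lebesgue G > 0"
  obtains a K where "compact K" "K \<subseteq> G" "K \<subseteq> box_at a" "0 < measure lborel K"
proof -
  let ?G = "\<lambda>n. G \<inter> box_at (2 * pi * real n)"
  have box: "box_at a \<in> sets lebesgue" for a
    unfolding box_at_def by auto
  have G_eq: "G = (\<Union>n. ?G n)"
  proof -
    have "\<exists>n. z \<in> box_at (2 * pi * real n)" if "z \<in> G" for z
    proof -
      have "z \<in> {0..T} \<times> circle"
        using that G(1) by blast
      then obtain t x where z: "z = (t, x)" "0 \<le> t" "0 \<le> x" "x < 2 * pi"
        by (cases z) (auto simp: circle_def)
      define n where "n = nat \<lfloor>t / (2 * pi)\<rfloor>"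
      have "real n = of_int \<lfloor>t / (2 * pi)\<rfloor>"
        using z(2) by (simp add: n_def)
      then have "real n \<le> t / (2 * pi)" "t / (2 * pi) < real n + 1"
        by linarith+
      then have "2 * pi * real n \<le> t" "t \<le> 2 * pi * real n + 2 * pi"
        by (simp_all add: field_simps)
      then have "z \<in> box_at (2 * pi * real n)"
        using z by (simp add: box_at_def)
      then show ?thesis by blast
    qed
    then show ?thesis by blast
  qed
  have "\<exists>n. emeasure lebesgue (?G n) \<noteq> 0"
  proof (rule ccontr)
    assume "\<not> ?thesis"
    then have "emeasure lebesgue (\<Union>n. ?G n) = 0"
      using G(2) box by (intro emeasure_UN_eq_0) auto
    then have "emeasure lebesgue G = 0"
      by (subst G_eq)
    with G(3) show False by simp
  qed
  then obtain n where n: "emeasure lebesgue (?G n) \<noteq> 0"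
    by blast
  define a where "a = 2 * pi * real n"
  let ?S = "G \<inter> box_at a"
  have S: "?S \<in> sets lebesgue"
    using G(2) box by blast
  have "emeasure lebesgue ?S \<le> emeasure lebesgue (box_at a)"
    using box by (intro emeasure_mono) auto
  also have "\<dots> < \<infinity>"
    by (simp add: box_at_def emeasure_lborel_cbox_eq)
  finally have fin: "emeasure lebesgue ?S = ennreal (measure lebesgue ?S)"
    by (intro emeasure_eq_ennreal_measure) auto
  then have pos: "0 < measure lebesgue ?S"
    using n unfolding a_def by (metis ennreal_0 measure_nonneg order_le_less)
  \<comment> \<open>The tolerance is the whole measure of \<open>?S\<close>, which rules out a null
    \<open>K\<close>.\<close>
  obtain K where K: "closed K" "K \<subseteq> ?S" "?S - K \<in> lmeasurable"
      "emeasure lebesgue (?S - K) < ennreal (measure lebesgue ?S)"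
    using S pos by (rule sets_lebesgue_inner_closed)
  have cK: "compact K"
    using K(1,2) bounded_box_at[of K a] by (auto simp: compact_eq_bounded_closed)
  have Kl: "K \<in> sets lebesgue"
    using cK by (simp add: fmeasurableD lmeasurable_compact)
  have "emeasure lebesgue K \<noteq> 0"
  proof
    assume "emeasure lebesgue K = 0"
    then have "emeasure lebesgue (K \<union> (?S - K)) \<le> emeasure lebesgue (?S - K)"
      using emeasure_subadditive[of K lebesgue "?S - K"] Kl S by auto
    moreover have "K \<union> (?S - K) = ?S"
      using K(2) by blast
    ultimately show False
      using K(4) fin by auto
  qed
  moreover have "emeasure lebesgue K = ennreal (measure lborel K)"
    using cK emeasure_compact_finite[OF cK] by (simp add: borel_compact emeasure_eq_ennreal_measure)
  ultimately have "0 < measure lborel K"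
    by (metis ennreal_0 measure_nonneg order_le_less)
  then show ?thesis
    using that[of K a] cK K(2) by blast
qed

lemma solution_L2_norm_le:
  assumes T: "0 < T" and G: "G \<subseteq> {0..T} \<times> circle" "G \<in> sets lebesgue"
    and K: "compact K" "K \<subseteq> G"
    and c: "0 < c" "\<And>b F. finite F \<Longrightarrow>
      c * energy b F \<le> (LINT z:K|lborel. (cmod (wave (poly p) b F z))\<^sup>2)"
    and u0: "u0 \<in> circle_L2" and u: "is_solution p T u0 u"
  shows "(L2_norm u0)\<^sup>2 \<le> 4 * pi / c * (LINT (t, x):G|lebesgue. (cmod (u t x))\<^sup>2)"
proof (rule field_le_epsilon)
  have Kb: "K \<in> sets borel" "bounded K"
    using K(1) by (auto simp: borel_compact compact_imp_bounded)
  let ?B = "{0..T} \<times> circle"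
  fix e :: real assume e: "0 < e"
  let ?I = "LINT (t, x):G|lebesgue. (cmod (u t x))\<^sup>2"
  \<comment> \<open>The truncation error \<open>r\<close> enters once directly and once through the
    strip, where it is at most \<open>T * r\<close> and gets the factor \<open>4 * pi / c\<close>;
    the two add up to \<open>e\<close>.\<close>
  define r where "r = e / (1 + 4 * pi * T / c)"
  have denom: "0 < 1 + 4 * pi * T / c"
    using c(1) T by (intro add_pos_pos) auto
  have r: "0 < r" "r * (1 + 4 * pi * T / c) = e"
    using e denom by (auto simp: r_def)
  obtain F where F: "finite F" "(L2_norm u0)\<^sup>2 - 2 * pi * energy (fourier_coeff u0) F < r"
    using parseval_circle[OF u0 r(1)] by blast
  let ?U = "wave (poly p) (fourier_coeff u0) F"
  have um: "(\<lambda>(t, x). u t x) \<in> borel_measurable (lebesgue_on ?B)"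
    using u by (simp add: is_solution_def)
  have Um: "?U \<in> borel_measurable borel"
    by (intro borel_measurable_continuous_onI continuous_on_wave)
  have Um': "?U \<in> borel_measurable (lebesgue_on ?B)"
    using Um by (intro measurable_restrict_space1 measurable_completion) simp
  have wm: "(\<lambda>(t, x). u t x - ?U (t, x)) \<in> borel_measurable (lebesgue_on ?B)"
    using borel_measurable_diff[OF um Um'] by (simp add: case_prod_unfold)
  have w: "set_integrable lebesgue ?B (\<lambda>(t, x). (cmod (u t x - ?U (t, x)))\<^sup>2)"
    "(LINT (t, x):?B|lebesgue. (cmod (u t x - ?U (t, x)))\<^sup>2) \<le> T * r"
  proof -
    have le: "(LINT x|lebesgue_on circle. (cmod (u t x - ?U (t, x)))\<^sup>2) \<le> r" if "t \<in> {0..T}" for t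
      using F(2) unfolding solution_remainder[OF u that F(1)] by simp
    note L2 = solution_remainder_circle_L2[OF u _ F(1)]
    show "set_integrable lebesgue ?B (\<lambda>(t, x). (cmod (u t x - ?U (t, x)))\<^sup>2)"
      by (rule set_integrable_strip[OF _ wm L2 le]) (use T in auto)
    show "(LINT (t, x):?B|lebesgue. (cmod (u t x - ?U (t, x)))\<^sup>2) \<le> T * r"
      by (rule set_integral_strip_le[OF _ wm L2 le]) (use T in auto)
  qed
  have ui: "set_integrable lebesgue ?B (\<lambda>(t, x). (cmod (u t x))\<^sup>2)"
  proof (rule set_integrable_strip[OF _ um])
    show "u t \<in> circle_L2" if "t \<in> {0..T}" for t
      using u that by (simp add: is_solution_def is_multiplier_image_def)
    \<comment> \<open>The empty frequency set turns the truncation formula into conservation of the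
      norm.\<close>
    show "(LINT x|lebesgue_on circle. (cmod (u t x))\<^sup>2) \<le> (L2_norm u0)\<^sup>2" if "t \<in> {0..T}" for t
      using solution_remainder[OF u that, of "{}"] by (simp add: wave_def energy_def)
  qed (use T in auto)
  have Kl: "K \<in> sets lebesgue"
    using Kb(1) by simp
  have KB: "K \<subseteq> ?B"
    using K(2) G(1) by blast
  have uG: "set_integrable lebesgue G (\<lambda>(t, x). (cmod (u t x))\<^sup>2)"
    by (rule set_integrable_subset[OF ui G(2,1)])
  have uK: "set_integrable lebesgue K (\<lambda>(t, x). (cmod (u t x))\<^sup>2)"
    and wK: "set_integrable lebesgue K (\<lambda>(t, x). (cmod (u t x - ?U (t, x)))\<^sup>2)"
    by (rule set_integrable_subset[OF _ Kl KB]; fact)+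
  have UK: "set_integrable lebesgue K (\<lambda>z. (cmod (?U z))\<^sup>2)"
    using set_integrable_wave_square[OF Kb]
    unfolding set_integrable_def using Um Kb by (subst integrable_completion) auto
  \<comment> \<open>Observability applies to the truncation \<open>?U\<close>, which is then
    compared with \<open>u\<close> by writing it as u - (u - ?U). The resulting factor 2, times 2 pi
    from Parseval, produces \<open>4 * pi / c\<close>.\<close>
  have "c * energy (fourier_coeff u0) F \<le> (LINT z:K|lborel. (cmod (?U z))\<^sup>2)"
    by (rule c(2)[OF F(1)])
  also have "\<dots> = (LINT z:K|lebesgue. (cmod (?U z))\<^sup>2)"
    unfolding set_lebesgue_integral_def using Um Kb by (intro integral_completion[symmetric]) auto
  also have "\<dots> \<le> (LINT z:K|lebesgue. 2 * (case z of (t, x) \<Rightarrow> (cmod (u t x))\<^sup>2)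
      + 2 * (case z of (t, x) \<Rightarrow> (cmod (u t x - ?U (t, x)))\<^sup>2))"
  proof (rule set_integral_mono[OF UK])
    show "set_integrable lebesgue K (\<lambda>z. 2 * (case z of (t, x) \<Rightarrow> (cmod (u t x))\<^sup>2)
        + 2 * (case z of (t, x) \<Rightarrow> (cmod (u t x - ?U (t, x)))\<^sup>2))"
      using uK wK by (intro set_integral_add set_integrable_mult_right) auto
    fix z
    show "(cmod (?U z))\<^sup>2 \<le> 2 * (case z of (t, x) \<Rightarrow> (cmod (u t x))\<^sup>2)
        + 2 * (case z of (t, x) \<Rightarrow> (cmod (u t x - ?U (t, x)))\<^sup>2)"
      using cmod_diff_square_le[of "u (fst z) (snd z)" "u (fst z) (snd z) - ?U z"]
      by (simp add: case_prod_unfold)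
  qed
  also have "\<dots> = 2 * (LINT (t, x):K|lebesgue. (cmod (u t x))\<^sup>2)
      + 2 * (LINT (t, x):K|lebesgue. (cmod (u t x - ?U (t, x)))\<^sup>2)"
    using uK wK by (subst set_integral_add) auto
  finally have 1: "c * energy (fourier_coeff u0) F \<le> 2 * (LINT (t, x):K|lebesgue. (cmod (u t x))\<^sup>2)
      + 2 * (LINT (t, x):K|lebesgue. (cmod (u t x - ?U (t, x)))\<^sup>2)" .
  have 2: "(LINT (t, x):K|lebesgue. (cmod (u t x))\<^sup>2) \<le> ?I"
    by (rule set_integral_subset_mono[OF uG Kl K(2)]) auto
  have "(LINT (t, x):K|lebesgue. (cmod (u t x - ?U (t, x)))\<^sup>2) \<le>
      (LINT (t, x):?B|lebesgue. (cmod (u t x - ?U (t, x)))\<^sup>2)"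
    by (rule set_integral_subset_mono[OF w(1) Kl KB]) auto
  with 1 2 w(2) have "c * energy (fourier_coeff u0) F \<le> 2 * ?I + 2 * (T * r)"
    by linarith
  then have "energy (fourier_coeff u0) F \<le> (2 * ?I + 2 * (T * r)) / c"
    using c(1) by (simp add: pos_le_divide_eq mult.commute)
  then have "2 * pi * energy (fourier_coeff u0) F \<le> 2 * pi * ((2 * ?I + 2 * (T * r)) / c)"
    by (intro mult_left_mono) auto
  also have "\<dots> = 4 * pi / c * ?I + r * (4 * pi * T / c)"
    by (simp add: add_divide_distrib algebra_simps)
  finally have "(L2_norm u0)\<^sup>2 \<le> 4 * pi / c * ?I + r * (1 + 4 * pi * T / c)"
    using F(2) by (simp add: distrib_left)
  then show "(L2_norm u0)\<^sup>2 \<le> 4 * pi / c * ?I + e"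
    by (simp add: r(2))
qed

theorem proposition1p5:
  fixes p :: "int poly" and T :: real and G :: "(real \<times> real) set"
  assumes "lead_coeff p = 1" and "degree p \<ge> 2"
    and "T > 0"
    and "G \<subseteq> {0..T} \<times> circle" and "G \<in> sets lebesgue" and "emeasure lebesgue G > 0"
  shows "\<exists>C::real. C > 0 \<and>
           (\<forall>u0 \<in> circle_L2. \<forall>u. is_solution p T u0 u \<longrightarrow>
              (L2_norm u0)\<^sup>2 \<le> C * (LINT (t, x):G|lebesgue. (cmod (u t x))\<^sup>2))"
proof -
  obtain a K where K: "compact K" "K \<subseteq> G" "K \<subseteq> box_at a" "0 < measure lborel K"
    by (rule compact_subset_positive_measure[OF assms(4-6)])
  have "observable (poly p) K {}"
    by (rule observable_compact[OF K(1,3,4) sparse_differences_poly[OF assms(2)]])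
  then obtain c where c: "0 < c" "\<And>b F. finite F \<Longrightarrow>
      c * energy b F \<le> (LINT z:K|lborel. (cmod (wave (poly p) b F z))\<^sup>2)"
    by (rule observable_emptyE) blast
  show ?thesis
  proof (intro exI[of _ "4 * pi / c"] conjI ballI allI impI)
    show "0 < 4 * pi / c"
      using c(1) by simp
  qed (rule solution_L2_norm_le[OF assms(3-5) K(1,2) c])
qed

end
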